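(* Let $\mathcal{F}=\{\phi_i\}_{i\in\mathbb{N}}$ be an infinite iterated function system on a compact metric space such that its attractor $K$ is compact, $\lim_{i\to\infty}\operatorname{Lip}(\phi_i)=0$, and there exists a curve (continuous map) $\gamma:[0,1]\to K$ whose image intersects $\phi_i(K)$ for all $i\in\mathbb{N}$. Then: (1) The attractor $K$ is the image of a curve, i.e. there is a continuous surjection $[0,1]\to K$. (2) If $\gamma$ is $\frac1s$-H\"older for some $s\ge 1$, then for each $\alpha>\max\{s,\operatorname{s-dim}(\mathcal{F})\}$ the attractor $K$ is the image of a $\frac1\alpha$-H\"older curve, i.e. there is a $\frac1\alpha$-H\"older continuous surjection $[0,1]\to K$.
   Context: An infinite iterated function system (IIFS) on a compact metric space $X$ is a countably infinite collection $\mathcal{F}=\{\phi_i : i\in\mathbb{N}\}$ of contractions $\phi_i:X\to X$ (not assumed injective). Here $\operatorname{Lip}(\phi)$ is the infimum of all $L>0$ for which $\phi$ is $L$-Lipschitz, and it is always assumed that $\operatorname{Lip}(\phi_i)\in(0,1)$ for every $i$. The attractor of $\mathcal{F}$ is $$K=\bigcup_{(i_n)\subset\mathbb{N}}\ \bigcap_{n=1}^{\infty}\phi_{i_1}\circ\cdots\circ\phi_{i_n}(X),$$ where the union is over all infinite sequences $(i_n)_{n\ge 1}$ in $\mathbb{N}$; it need not be compact in general. The similarity dimension is $\operatorname{s-dim}(\mathcal{F})=\inf\{t\ge 0:\psi_{\mathcal{F}}(t)\le 1\}$ (equal to $+\infty$ if the set is empty), where $\psi_{\mathcal{F}}(t)=\sum_{i\in\mathbb{N}}\operatorname{Lip}(\phi_i)^t$.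 A map $f$ from $[0,1]$ to a metric space with metric $d$ is $\frac1\alpha$-H\"older if there is $H\geq 0$ with $d(f(x),f(y))\le H|x-y|^{1/\alpha}$ for all $x,y\in[0,1]$. *)

theory Defs
  imports "HOL-Analysis.Analysis"
begin

text \<open>The ambient compact metric space is a compact set \<open>X\<close> in a metric space type, and maps of
  \<open>X\<close> are considered on \<open>X\<close> only.\<close>

definition Lip :: "'a::metric_space set \<Rightarrow> ('a \<Rightarrow> 'a) \<Rightarrow> real" where
  "Lip X f = Inf {L. 0 < L \<and> L-lipschitz_on X f}"

text \<open>\<open>Lip\<close> is meaningful only for Lipschitz maps (the infimum of the empty set of reals is
  unspecified), so being a contraction is required separately from the bounds on \<open>Lip\<close>.\<close>

definition IIFS :: "'a::metric_space set \<Rightarrow> (nat \<Rightarrow> 'a \<Rightarrow> 'a) \<Rightarrow> bool" where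
  "IIFS X \<phi> \<longleftrightarrow> compact X \<and>
     (\<forall>i. \<phi> i \<in> X \<rightarrow> X \<and> (\<exists>L<1. L-lipschitz_on X (\<phi> i)) \<and> 0 < Lip X (\<phi> i) \<and> Lip X (\<phi> i) < 1)"

text \<open>\<open>iterate \<phi> w n\<close> is the composition of \<open>\<phi> (w 0)\<close> (outermost), ..., \<open>\<phi> (w (n - 1))\<close> (innermost).\<close>

primrec iterate :: "(nat \<Rightarrow> 'a \<Rightarrow> 'a) \<Rightarrow> (nat \<Rightarrow> nat) \<Rightarrow> nat \<Rightarrow> 'a \<Rightarrow> 'a" where
  "iterate \<phi> w 0 = id"
| "iterate \<phi> w (Suc n) = iterate \<phi> w n \<circ> \<phi> (w n)"

definition attractor :: "'a set \<Rightarrow> (nat \<Rightarrow> 'a \<Rightarrow> 'a) \<Rightarrow> 'a set" where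
  "attractor X \<phi> = (\<Union>w. \<Inter>n\<in>{1..}. iterate \<phi> w n ` X)"

definition psi :: "'a::metric_space set \<Rightarrow> (nat \<Rightarrow> 'a \<Rightarrow> 'a) \<Rightarrow> real \<Rightarrow> ennreal" where
  "psi X \<phi> t = (\<Sum>i. ennreal (Lip X (\<phi> i) powr t))"

definition s_dim :: "'a::metric_space set \<Rightarrow> (nat \<Rightarrow> 'a \<Rightarrow> 'a) \<Rightarrow> ereal" where
  "s_dim X \<phi> = Inf (ereal ` {t. 0 \<le> t \<and> psi X \<phi> t \<le> 1})"

definition holder_on :: "real \<Rightarrow> 'a::metric_space set \<Rightarrow> ('a \<Rightarrow> 'b::metric_space) \<Rightarrow> bool" where
  "holder_on \<beta> U f \<longleftrightarrow> (\<exists>H\<ge>0. \<forall>x\<in>U. \<forall>y\<in>U. dist (f x) (f y) \<le> H * dist x y powr \<beta>)"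

end

theory Submission
  imports Defs
begin

text \<open>
  Write \<open>K\<close> for the attractor and \<open>\<gamma> (t i) = \<phi> i (\<kappa> i)\<close> with \<open>\<kappa> i \<in> K\<close>. Curves are built as fixed points of a
  splicing operation: a curve of a family follows a given base curve, except that on some disjoint
  intervals it runs through \<open>\<phi> j\<close>-images of other curves of the family. As the maps contract, such a
  family exists and depends only on the base curves, and its members are continuous if the base curves are.

  This is used twice. First it joins any two points \<open>x\<close>, \<open>y\<close> of \<open>K\<close>: if \<open>x \<in> \<phi> i ` K\<close> and \<open>y \<in> \<phi> j ` K\<close> with
  \<open>i \<noteq> j\<close>, go inside \<open>\<phi> i ` K\<close> to \<open>\<gamma>\<close>, along \<open>\<gamma>\<close>, and inside \<open>\<phi> j ` K\<close> to \<open>y\<close>. Then, for each \<open>x\<close>, the loop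
  from \<open>x\<close> to \<open>\<gamma> 0\<close>, along \<open>\<gamma>\<close>, and back to \<open>x\<close> is interrupted at each \<open>t i\<close> by the \<open>\<phi> i\<close>-image of the loop
  of \<open>\<kappa> i\<close>. The resulting loops fill \<open>K\<close>.

  For the Hoelder exponent \<open>1 / \<alpha>\<close>, choose \<open>\<beta> < \<alpha>\<close> with \<open>\<Sum>i. (Lip (\<phi> i)) powr \<beta> < 1\<close> and give the pieces with
  \<open>\<phi> i\<close> the time \<open>(Lip (\<phi> i)) powr \<beta>\<close>. Then \<open>\<phi> i\<close> shrinks Hoelder constants by a factor \<open>r < 1\<close>, so the
  errors of the infinitely many levels add up to a geometric series; with
  \<open>\<beta> = \<alpha>\<close> the factor would be \<open>1\<close>.
\<close>

section \<open>Families of spliced curves\<close>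

definition holder_bound :: "real \<Rightarrow> real \<Rightarrow> real set \<Rightarrow> (real \<Rightarrow> 'a::metric_space) \<Rightarrow> bool" where
  "holder_bound \<theta> H U f \<longleftrightarrow> (\<forall>x\<in>U. \<forall>y\<in>U. dist (f x) (f y) \<le> H * dist x y powr \<theta>)"

lemma holder_boundD:
  "holder_bound \<theta> H U f \<Longrightarrow> x \<in> U \<Longrightarrow> y \<in> U \<Longrightarrow> dist (f x) (f y) \<le> H * dist x y powr \<theta>"
  by (auto simp: holder_bound_def)

locale contractions =
  fixes K :: "'a::metric_space set" and \<phi> :: "nat \<Rightarrow> 'a \<Rightarrow> 'a" and L :: "nat \<Rightarrow> real" and q D :: real
  assumes compact_K: "compact K"
    and maps_into: "x \<in> K \<Longrightarrow> \<phi> j x \<in> K"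
    and contracts: "x \<in> K \<Longrightarrow> y \<in> K \<Longrightarrow> dist (\<phi> j x) (\<phi> j y) \<le> L j * dist x y"
    and L_nonneg: "0 \<le> L j" and L_le: "L j \<le> q" and q_less: "q < 1"
    and L_tendsto: "L \<longlonglongrightarrow> 0"
    and diam: "x \<in> K \<Longrightarrow> y \<in> K \<Longrightarrow> dist x y \<le> D"
    and D_nonneg: "0 \<le> D"
begin

lemma q_nonneg: "0 \<le> q"
  using L_nonneg L_le by (rule order_trans)

lemma qpow_tendsto: "(\<lambda>n. C + q ^ n * D) \<longlonglongrightarrow> C"
  using q_nonneg q_less by (auto intro!: tendsto_eq_intros LIMSEQ_power_zero)

text \<open>The quantitative estimates are proved by induction on \<open>n\<close> with an error
  \<open>q ^ n * D\<close>, which makes the case \<open>n = 0\<close> trivial. Here the error is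
  removed afterwards.\<close>

lemma le_qpow_imp_le:
  assumes "\<And>n. r \<le> C + q ^ n * D"
  shows "r \<le> C"
  by (rule LIMSEQ_le_const[OF qpow_tendsto]) (use assms in auto)

text \<open>The induction step of those estimates. The main term keeps the individual factor
  \<open>L j\<close>, which the Hoelder bounds exploit; for the error the uniform factor
  \<open>q\<close> is enough.\<close>

lemma contracts_qpow:
  assumes "x \<in> K" "y \<in> K" "dist x y \<le> C + q ^ n * D"
  shows "dist (\<phi> j x) (\<phi> j y) \<le> L j * C + q ^ Suc n * D"
proof -
  have "dist (\<phi> j x) (\<phi> j y) \<le> L j * (C + q ^ n * D)"
    by (rule order_trans[OF contracts[OF assms(1,2)] mult_left_mono[OF assms(3) L_nonneg]])
  moreover have "L j * (q ^ n * D) \<le> q * (q ^ n * D)"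
    using L_le q_nonneg D_nonneg by (intro mult_right_mono) auto
  ultimately show ?thesis by (simp add: algebra_simps)
qed

end

text \<open>The curve of \<open>\<sigma>\<close> follows \<open>base \<sigma>\<close> outside the intervals \<open>[a \<sigma> j, b \<sigma> j]\<close> with \<open>j \<in> J \<sigma>\<close>, and on each of them it is
  the \<open>\<phi> j\<close>-image of the curve of \<open>child \<sigma> j\<close>. Values of \<open>base \<sigma>\<close> inside these intervals are irrelevant.\<close>

locale spliced_curves = contractions K \<phi> L q D
  for K :: "'a::metric_space set" and \<phi> L q D +
  fixes S :: "'s set" and J :: "'s \<Rightarrow> nat set" and a b :: "'s \<Rightarrow> nat \<Rightarrow> real"
    and child :: "'s \<Rightarrow> nat \<Rightarrow> 's" and base :: "'s \<Rightarrow> real \<Rightarrow> 'a"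
  assumes piece: "\<sigma> \<in> S \<Longrightarrow> j \<in> J \<sigma> \<Longrightarrow> 0 \<le> a \<sigma> j \<and> a \<sigma> j < b \<sigma> j \<and> b \<sigma> j \<le> 1"
    and child_in: "\<sigma> \<in> S \<Longrightarrow> j \<in> J \<sigma> \<Longrightarrow> child \<sigma> j \<in> S"
    and pieces_disjoint: "\<sigma> \<in> S \<Longrightarrow> i \<in> J \<sigma> \<Longrightarrow> j \<in> J \<sigma> \<Longrightarrow> i \<noteq> j \<Longrightarrow> b \<sigma> i \<le> a \<sigma> j \<or> b \<sigma> j \<le> a \<sigma> i"
    and base_in: "\<sigma> \<in> S \<Longrightarrow> u \<in> {0..1} \<Longrightarrow> base \<sigma> u \<in> K"
    and base_a: "\<sigma> \<in> S \<Longrightarrow> j \<in> J \<sigma> \<Longrightarrow> base \<sigma> (a \<sigma> j) = \<phi> j (base (child \<sigma> j) 0)"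
    and base_b: "\<sigma> \<in> S \<Longrightarrow> j \<in> J \<sigma> \<Longrightarrow> base \<sigma> (b \<sigma> j) = \<phi> j (base (child \<sigma> j) 1)"
begin

text \<open>The ends of the pieces are counted among the gap points. There \<open>base_a\<close> and
  \<open>base_b\<close> make the base curve agree with the pieces, so pieces may touch each
  other.\<close>

definition gap :: "'s \<Rightarrow> real set" where
  "gap \<sigma> = {u \<in> {0..1}. \<forall>j\<in>J \<sigma>. u \<le> a \<sigma> j \<or> b \<sigma> j \<le> u}"

definition pt :: "'s \<Rightarrow> nat \<Rightarrow> real \<Rightarrow> real" where
  "pt \<sigma> j v = a \<sigma> j + (b \<sigma> j - a \<sigma> j) * v"

text \<open>The splicing unfolded \<open>n\<close> times, with base curves at the bottom. Open
  pieces of a member of \<open>S\<close> are disjoint, so \<open>SOME\<close> has only one index to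
  choose from.\<close>

primrec approx :: "nat \<Rightarrow> 's \<Rightarrow> real \<Rightarrow> 'a" where
  "approx 0 \<sigma> u = base \<sigma> u"
| "approx (Suc n) \<sigma> u = (if u \<in> gap \<sigma> then base \<sigma> u else
     let j = (SOME j. j \<in> J \<sigma> \<and> a \<sigma> j < u \<and> u < b \<sigma> j)
     in \<phi> j (approx n (child \<sigma> j) ((u - a \<sigma> j) / (b \<sigma> j - a \<sigma> j))))"

definition curve :: "'s \<Rightarrow> real \<Rightarrow> 'a" where
  "curve \<sigma> u = lim (\<lambda>n. approx n \<sigma> u)"

lemma pt_0 [simp]: "pt \<sigma> j 0 = a \<sigma> j" and pt_1 [simp]: "pt \<sigma> j 1 = b \<sigma> j"
  by (auto simp: pt_def)

lemma pt_in:
  assumes "\<sigma> \<in> S" "j \<in> J \<sigma>" "v \<in> {0..1}"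
  shows "pt \<sigma> j v \<in> {a \<sigma> j..b \<sigma> j}"
proof -
  have "0 \<le> (b \<sigma> j - a \<sigma> j) * v" "0 \<le> (b \<sigma> j - a \<sigma> j) * (1 - v)"
    using assms piece[OF assms(1,2)] by (intro mult_nonneg_nonneg; simp)+
  then show ?thesis
    by (simp add: pt_def algebra_simps)
qed

lemma pt_surj:
  assumes "\<sigma> \<in> S" "j \<in> J \<sigma>" "u \<in> {a \<sigma> j..b \<sigma> j}"
  obtains v where "v \<in> {0..1}" "u = pt \<sigma> j v"
proof
  show "(u - a \<sigma> j) / (b \<sigma> j - a \<sigma> j) \<in> {0..1}" "u = pt \<sigma> j ((u - a \<sigma> j) / (b \<sigma> j - a \<sigma> j))"
    using assms piece[OF assms(1,2)] by (auto simp: pt_def field_simps)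
qed

lemma dist_pt:
  assumes "\<sigma> \<in> S" "j \<in> J \<sigma>"
  shows "dist (pt \<sigma> j v) (pt \<sigma> j w) = (b \<sigma> j - a \<sigma> j) * dist v w"
  using piece[OF assms] by (simp add: pt_def dist_real_def abs_mult flip: right_diff_distrib)

lemma ends_gap:
  assumes "\<sigma> \<in> S"
  shows "0 \<in> gap \<sigma>" "1 \<in> gap \<sigma>" "j \<in> J \<sigma> \<Longrightarrow> a \<sigma> j \<in> gap \<sigma>" "j \<in> J \<sigma> \<Longrightarrow> b \<sigma> j \<in> gap \<sigma>"
proof -
  show "0 \<in> gap \<sigma>" "1 \<in> gap \<sigma>"
    using piece[OF assms] by (auto simp: gap_def)
  assume j: "j \<in> J \<sigma>"
  have "a \<sigma> j \<le> a \<sigma> i \<or> b \<sigma> i \<le> a \<sigma> j" "b \<sigma> j \<le> a \<sigma> i \<or> b \<sigma> i \<le> b \<sigma> j" if "i \<in> J \<sigma>" for i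
    using pieces_disjoint[OF assms that j] piece[OF assms that] piece[OF assms j]
    by (cases "i = j"; auto)+
  then show "a \<sigma> j \<in> gap \<sigma>" "b \<sigma> j \<in> gap \<sigma>"
    using piece[OF assms j] by (auto simp: gap_def)
qed

lemma gap_cases:
  assumes "\<sigma> \<in> S" "u \<in> {0..1}"
  obtains "u \<in> gap \<sigma>" | j where "j \<in> J \<sigma>" "a \<sigma> j < u" "u < b \<sigma> j"
  using assms by (force simp: gap_def)

lemma gap_sub: "u \<in> gap \<sigma> \<Longrightarrow> u \<in> {0..1}"
  by (simp add: gap_def)

lemma approx_gap: "u \<in> gap \<sigma> \<Longrightarrow> approx n \<sigma> u = base \<sigma> u"
  by (cases n) auto

text \<open>For \<open>v = 0\<close> and \<open>v = 1\<close> both sides are values of base curves,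
  matched by \<open>base_a\<close> and \<open>base_b\<close>. The recursion thus holds on closed
  pieces.\<close>

lemma approx_pt:
  assumes "\<sigma> \<in> S" "j \<in> J \<sigma>" "v \<in> {0..1}"
  shows "approx (Suc n) \<sigma> (pt \<sigma> j v) = \<phi> j (approx n (child \<sigma> j) v)"
proof -
  note c = child_in[OF assms(1,2)]
  consider "v = 0" | "v = 1" | "0 < v" "v < 1" using assms(3) by force
  then show ?thesis
  proof cases
    case 1
    then show ?thesis
      using approx_gap[OF ends_gap(1)[OF c]] approx_gap[OF ends_gap(3)[OF assms(1,2)]] base_a[OF assms(1,2)]
      by simp
  next
    case 2
    then show ?thesis
      using approx_gap[OF ends_gap(2)[OF c]] approx_gap[OF ends_gap(4)[OF assms(1,2)]] base_b[OF assms(1,2)]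
      by simp
  next
    case 3
    let ?u = "pt \<sigma> j v"
    have ab: "a \<sigma> j < b \<sigma> j" using piece[OF assms(1,2)] by simp
    have "(b \<sigma> j - a \<sigma> j) * v < (b \<sigma> j - a \<sigma> j) * 1"
      using ab 3 by (intro mult_strict_left_mono) auto
    moreover have "(b \<sigma> j - a \<sigma> j) * v > 0" using ab 3 by simp
    ultimately have u: "a \<sigma> j < ?u" "?u < b \<sigma> j" by (auto simp: pt_def)
    have "(SOME j. j \<in> J \<sigma> \<and> a \<sigma> j < ?u \<and> ?u < b \<sigma> j) = j"
    proof (rule some_equality)
      fix i assume i: "i \<in> J \<sigma> \<and> a \<sigma> i < ?u \<and> ?u < b \<sigma> i"
      then show "i = j" using pieces_disjoint[OF assms(1) _ assms(2), of i] u by force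
    qed (use assms u in auto)
    moreover have "?u \<notin> gap \<sigma>" using u assms by (force simp: gap_def)
    moreover have "(?u - a \<sigma> j) / (b \<sigma> j - a \<sigma> j) = v" using ab by (simp add: pt_def)
    ultimately show ?thesis by simp
  qed
qed

lemma approx_in: "\<sigma> \<in> S \<Longrightarrow> u \<in> {0..1} \<Longrightarrow> approx n \<sigma> u \<in> K"
proof (induction n arbitrary: \<sigma> u)
  case 0
  then show ?case using base_in by simp
next
  case (Suc n)
  from Suc.prems show ?case
  proof (cases rule: gap_cases)
    case 1
    then show ?thesis using approx_gap[OF 1] base_in[OF Suc.prems] by simp
  next
    case (2 j)
    obtain v where v: "v \<in> {0..1}" "u = pt \<sigma> j v"
      using pt_surj[OF Suc.prems(1) 2(1)] 2 by (metis atLeastAtMost_iff less_imp_le)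
    show ?thesis
      unfolding v(2) approx_pt[OF Suc.prems(1) 2(1) v(1)]
      by (intro maps_into Suc.IH child_in Suc.prems 2 v)
  qed
qed

text \<open>Both approximations descend through the same nested pieces. Either they meet a gap
  within \<open>n\<close> levels and agree there, or \<open>n\<close> contractions have been applied
  to two points of \<open>K\<close>.\<close>

lemma approx_close:
  "\<sigma> \<in> S \<Longrightarrow> u \<in> {0..1} \<Longrightarrow> dist (approx n \<sigma> u) (approx (n + m) \<sigma> u) \<le> 0 + q ^ n * D"
proof (induction n arbitrary: \<sigma> u)
  case 0
  then show ?case using approx_in diam by (simp del: approx.simps)
next
  case (Suc n)
  from Suc.prems show ?case
  proof (cases rule: gap_cases)
    case 1
    then show ?thesis using approx_gap[OF 1] q_nonneg D_nonneg by (simp del: approx.simps)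
  next
    case (2 j)
    obtain v where v: "v \<in> {0..1}" "u = pt \<sigma> j v"
      using pt_surj[OF Suc.prems(1) 2(1)] 2 by (metis atLeastAtMost_iff less_imp_le)
    note c = child_in[OF Suc.prems(1) 2(1)]
    show ?thesis
      using contracts_qpow[OF approx_in[OF c v(1)] approx_in[OF c v(1)] Suc.IH[OF c v(1)], of j]
        approx_pt[OF Suc.prems(1) 2(1) v(1)] v(2) by (simp del: approx.simps power_Suc)
  qed
qed

lemma approx_tendsto:
  assumes "\<sigma> \<in> S" "u \<in> {0..1}"
  shows "(\<lambda>n. approx n \<sigma> u) \<longlonglongrightarrow> curve \<sigma> u" and curve_in: "curve \<sigma> u \<in> K"
proof -
  have "Cauchy (\<lambda>n. approx n \<sigma> u)"
  proof (rule metric_CauchyI)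
    fix e :: real assume "0 < e"
    then have "\<forall>\<^sub>F n in sequentially. 0 + q ^ n * D < e / 2"
      using qpow_tendsto[of 0] by (intro order_tendstoD(2)) auto
    then obtain N where N: "0 + q ^ N * D < e / 2" by (auto simp: eventually_sequentially)
    show "\<exists>M. \<forall>m\<ge>M. \<forall>n\<ge>M. dist (approx m \<sigma> u) (approx n \<sigma> u) < e"
    proof (intro exI allI impI)
      fix m n assume "N \<le> m" "N \<le> n"
      then show "dist (approx m \<sigma> u) (approx n \<sigma> u) < e"
        using approx_close[OF assms, of N "m - N"] approx_close[OF assms, of N "n - N"] N
          dist_triangle3[of "approx m \<sigma> u" "approx n \<sigma> u" "approx N \<sigma> u"] by simp
    qed
  qed
  \<comment> \<open>The ambient space need not be complete; compactness of \<open>K\<close> supplies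
    the limit.\<close>
  then obtain l where "l \<in> K" "(\<lambda>n. approx n \<sigma> u) \<longlonglongrightarrow> l"
    using compact_imp_complete[OF compact_K] approx_in[OF assms] unfolding complete_def by metis
  then show "(\<lambda>n. approx n \<sigma> u) \<longlonglongrightarrow> curve \<sigma> u" "curve \<sigma> u \<in> K"
    using limI unfolding curve_def by metis+
qed

lemma curve_gap: "u \<in> gap \<sigma> \<Longrightarrow> curve \<sigma> u = base \<sigma> u"
  by (simp add: curve_def approx_gap)

text \<open>Together with \<open>curve_gap\<close> this is the fixed point equation of the splicing.
  Later estimates rest on these two facts and no longer on \<open>approx\<close>.\<close>

lemma curve_pt:
  assumes "\<sigma> \<in> S" "j \<in> J \<sigma>" "v \<in> {0..1}"
  shows "curve \<sigma> (pt \<sigma> j v) = \<phi> j (curve (child \<sigma> j) v)"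
proof (rule LIMSEQ_unique)
  note c = child_in[OF assms(1,2)]
  have "pt \<sigma> j v \<in> {0..1}" using pt_in[OF assms] piece[OF assms(1,2)] by auto
  from LIMSEQ_Suc[OF approx_tendsto(1)[OF assms(1) this]]
  show "(\<lambda>n. \<phi> j (approx n (child \<sigma> j) v)) \<longlonglongrightarrow> curve \<sigma> (pt \<sigma> j v)"
    unfolding approx_pt[OF assms] .
  have "(L j)-lipschitz_on K (\<phi> j)"
    by (rule lipschitz_onI) (auto intro: contracts L_nonneg)
  then have "continuous_on K (\<phi> j)" by (rule lipschitz_on_continuous_on)
  then show "(\<lambda>n. \<phi> j (approx n (child \<sigma> j) v)) \<longlonglongrightarrow> \<phi> j (curve (child \<sigma> j) v)"
    using approx_tendsto(1)[OF c assms(3)] curve_in[OF c assms(3)] approx_in[OF c assms(3)]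
    by (intro continuous_on_tendsto_compose[where f = "\<phi> j" and s = K]) (auto simp del: approx.simps)
qed

lemma curve_0: "\<sigma> \<in> S \<Longrightarrow> curve \<sigma> 0 = base \<sigma> 0"
  and curve_1: "\<sigma> \<in> S \<Longrightarrow> curve \<sigma> 1 = base \<sigma> 1"
  by (simp_all add: curve_gap ends_gap)

text \<open>If every map labels a piece, each curve visits all iterated images of \<open>K\<close>:
  the child curve in the piece of \<open>j\<close> comes close to \<open>y\<close>, and
  \<open>\<phi> j\<close> shrinks the remaining distance.\<close>

lemma curve_dense:
  assumes cover: "\<And>x. x \<in> K \<Longrightarrow> \<exists>j y. y \<in> K \<and> x = \<phi> j y" and all: "\<And>\<sigma>. \<sigma> \<in> S \<Longrightarrow> J \<sigma> = UNIV"
  shows "\<sigma> \<in> S \<Longrightarrow> z \<in> K \<Longrightarrow> \<exists>u\<in>{0..1}. dist (curve \<sigma> u) z \<le> 0 + q ^ n * D"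
proof (induction n arbitrary: \<sigma> z)
  case 0
  then have "dist (curve \<sigma> 0) z \<le> D" using curve_in[of \<sigma> 0] diam by simp
  then show ?case by (intro bexI[of _ 0]) auto
next
  case (Suc n)
  obtain j y where y: "y \<in> K" "z = \<phi> j y" using cover[OF Suc.prems(2)] by blast
  have j: "j \<in> J \<sigma>" using all Suc.prems by simp
  note c = child_in[OF Suc.prems(1) j]
  obtain v where v: "v \<in> {0..1}" "dist (curve (child \<sigma> j) v) y \<le> 0 + q ^ n * D"
    using Suc.IH[OF c y(1)] by blast
  show ?case
  proof
    show "pt \<sigma> j v \<in> {0..1}" using pt_in[OF Suc.prems(1) j v(1)] piece[OF Suc.prems(1) j] by auto
    show "dist (curve \<sigma> (pt \<sigma> j v)) z \<le> 0 + q ^ Suc n * D"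
      using contracts_qpow[OF curve_in[OF c v(1)] y(1) v(2), of j] curve_pt[OF Suc.prems(1) j v(1)] y(2)
      by (simp del: power_Suc)
  qed
qed

text \<open>Inside a piece the claim is inherited from the child curve one level below. At a gap
  point infinitely many pieces may accumulate, but all except finitely many have small images; on a
  small piece the curve is compared with its value at an end of the piece, where continuity of the
  base curve applies.\<close>

lemma curve_near:
  assumes base_cont: "\<And>\<sigma>. \<sigma> \<in> S \<Longrightarrow> continuous_on (gap \<sigma>) (base \<sigma>)"
  shows "\<sigma> \<in> S \<Longrightarrow> u \<in> {0..1} \<Longrightarrow> 0 < e \<Longrightarrow>
    \<forall>\<^sub>F w in at u within {0..1}. dist (curve \<sigma> u) (curve \<sigma> w) \<le> e + q ^ n * D"
proof (induction n arbitrary: \<sigma> u e)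
  case 0
  have "dist (curve \<sigma> u) (curve \<sigma> w) \<le> e + q ^ 0 * D" if "w \<in> {0..1}" for w
    using diam[OF curve_in[OF 0(1,2)] curve_in[OF 0(1) that]] 0 by simp
  then show ?case by (auto simp: eventually_at intro!: exI[of _ 1])
next
  case (Suc n)
  note S = Suc.prems(1)
  \<comment> \<open>With closed pieces this also gives the one-sided estimate when \<open>u\<close>
    is an end of a piece. If \<open>u\<close> lies outside, no \<open>w\<close> near
    \<open>u\<close> is in the piece.\<close>
  have inpiece: "\<forall>\<^sub>F w in at u within {0..1}. w \<in> {a \<sigma> j..b \<sigma> j} \<longrightarrow>
      dist (curve \<sigma> u) (curve \<sigma> w) \<le> e + q ^ Suc n * D" if j: "j \<in> J \<sigma>" for j
  proof (cases "u \<in> {a \<sigma> j..b \<sigma> j}")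
    case False
    have "\<forall>\<^sub>F w in at u within {0..1}. w \<in> - {a \<sigma> j..b \<sigma> j}"
      using False by (intro topological_tendstoD[OF tendsto_ident_at]) auto
    then show ?thesis by eventually_elim auto
  next
    case True
    note c = child_in[OF S j]
    obtain v where v: "v \<in> {0..1}" "u = pt \<sigma> j v" using pt_surj[OF S j True] .
    obtain d where d: "d > 0" "\<And>w. w \<in> {0..1} \<Longrightarrow> w \<noteq> v \<Longrightarrow> dist w v < d \<Longrightarrow>
        dist (curve (child \<sigma> j) v) (curve (child \<sigma> j) w) \<le> e + q ^ n * D"
      using Suc.IH[OF c v(1) Suc.prems(3)] unfolding eventually_at by blast
    have ab: "a \<sigma> j < b \<sigma> j" using piece[OF S j] by simp
    have "dist (curve \<sigma> u) (curve \<sigma> w) \<le> e + q ^ Suc n * D"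
      if w: "w \<in> {a \<sigma> j..b \<sigma> j}" "dist w u < (b \<sigma> j - a \<sigma> j) * d" for w
    proof -
      obtain x where x: "x \<in> {0..1}" "w = pt \<sigma> j x" using pt_surj[OF S j w(1)] .
      have "dist x v < d" using w(2) ab unfolding x v dist_pt[OF S j] by simp
      then have "dist (curve (child \<sigma> j) v) (curve (child \<sigma> j) x) \<le> e + q ^ n * D"
        using d(2)[OF x(1)] Suc.prems(3) q_nonneg D_nonneg by (cases "x = v") auto
      from contracts_qpow[OF curve_in[OF c v(1)] curve_in[OF c x(1)] this]
      have "dist (curve \<sigma> u) (curve \<sigma> w) \<le> L j * e + q ^ Suc n * D"
        using curve_pt[OF S j] v x by simp
      moreover have "L j * e \<le> 1 * e"
        using L_le[of j] q_less Suc.prems(3) by (intro mult_right_mono) auto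
      ultimately show ?thesis by simp
    qed
    then show ?thesis
      unfolding eventually_at using ab d(1) by (intro exI[of _ "(b \<sigma> j - a \<sigma> j) * d"]) auto
  qed
  from S Suc.prems(2) show ?case
  proof (cases rule: gap_cases)
    case (2 j)
    have "\<forall>\<^sub>F w in at u within {0..1}. w \<in> {a \<sigma> j<..<b \<sigma> j}"
      using 2 by (intro topological_tendstoD[OF tendsto_ident_at]) auto
    with inpiece[OF 2(1)] show ?thesis by eventually_elim auto
  next
    case 1
    obtain d where d: "d > 0" "\<And>w. w \<in> gap \<sigma> \<Longrightarrow> dist w u < d \<Longrightarrow> dist (base \<sigma> u) (base \<sigma> w) < e / 2"
      using base_cont[OF S] 1 Suc.prems(3) unfolding continuous_on_iff
      by (metis dist_commute half_gt_zero)
    \<comment> \<open>Pieces whose images may be large; as \<open>L\<close> tends to 0 there are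
      finitely many, and \<open>inpiece\<close> handles them.\<close>
    let ?I = "{j. e / 2 < L j * D}"
    have "(\<lambda>j. L j * D) \<longlonglongrightarrow> 0"
      using L_tendsto by (auto intro!: tendsto_eq_intros)
    then have "\<forall>\<^sub>F j in sequentially. L j * D < e / 2"
      using Suc.prems(3) by (intro order_tendstoD(2)) auto
    then have "\<forall>\<^sub>F j in cofinite. \<not> e / 2 < L j * D"
      unfolding cofinite_eq_sequentially by eventually_elim auto
    then have "finite (?I \<inter> J \<sigma>)" by (simp add: eventually_cofinite)
    then have "\<forall>\<^sub>F w in at u within {0..1}. \<forall>j\<in>?I \<inter> J \<sigma>. w \<in> {a \<sigma> j..b \<sigma> j} \<longrightarrow>
        dist (curve \<sigma> u) (curve \<sigma> w) \<le> e + q ^ Suc n * D"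
      using inpiece by (intro eventually_ball_finite) auto
    moreover have "\<forall>\<^sub>F w in at u within {0..1}. w \<in> {0..1} \<and> dist w u < d"
      unfolding eventually_at using d(1) by auto
    ultimately show ?thesis
    proof eventually_elim
      case (elim w)
      have pos: "0 \<le> q ^ Suc n * D" using q_nonneg D_nonneg by simp
      from S elim(2) have "w \<in> {0..1}" by simp
      with S show ?case
      proof (cases rule: gap_cases)
        case w: 1
        then show ?thesis using d(2)[OF w] elim(2) curve_gap[OF w] curve_gap[OF 1] pos Suc.prems(3) by simp
      next
        case w: (2 j)
        show ?thesis
        proof (cases "j \<in> ?I")
          case True
          moreover have "w \<in> {a \<sigma> j..b \<sigma> j}" using w by simp
          ultimately show ?thesis using elim(1) w(1) by blast
        next
          case False
          \<comment> \<open>The end of the piece that faces \<open>u\<close>; it lies between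
            \<open>u\<close> and \<open>w\<close>, hence also close to \<open>u\<close>.\<close>
          define v :: real where "v = (if u \<le> a \<sigma> j then 0 else 1)"
          have "u \<le> a \<sigma> j \<or> b \<sigma> j \<le> u" using 1 w by (auto simp: gap_def)
          then have near: "dist (pt \<sigma> j v) u < d"
            using elim(2) w by (auto simp: v_def dist_real_def)
          have v: "v \<in> {0..1}" "pt \<sigma> j v \<in> gap \<sigma>" using ends_gap[OF S] w by (auto simp: v_def)
          note c = child_in[OF S w(1)]
          obtain x where x: "x \<in> {0..1}" "w = pt \<sigma> j x" using pt_surj[OF S w(1)] w by (metis atLeastAtMost_iff less_imp_le)
          have "dist (curve \<sigma> (pt \<sigma> j v)) (curve \<sigma> w) \<le> L j * D"
            using curve_pt[OF S w(1)] v x contracts[OF curve_in[OF c v(1)] curve_in[OF c x(1)], of j]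
              mult_left_mono[OF diam[OF curve_in[OF c v(1)] curve_in[OF c x(1)]] L_nonneg[of j]] by auto
          moreover have "dist (curve \<sigma> u) (curve \<sigma> (pt \<sigma> j v)) < e / 2"
            using d(2)[OF v(2) near] curve_gap[OF 1] curve_gap[OF v(2)] by simp
          ultimately show ?thesis
            using False pos dist_triangle[of "curve \<sigma> u" "curve \<sigma> w" "curve \<sigma> (pt \<sigma> j v)"] by simp
        qed
      qed
    qed
  qed
qed

lemma curve_continuous:
  assumes "\<And>\<sigma>. \<sigma> \<in> S \<Longrightarrow> continuous_on (gap \<sigma>) (base \<sigma>)" "\<sigma> \<in> S"
  shows "continuous_on {0..1} (curve \<sigma>)"
  unfolding continuous_on_def
proof (intro ballI tendstoI)
  fix u e :: real assume u: "u \<in> {0..1}" and e: "0 < e"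
  then have "\<forall>\<^sub>F n in sequentially. 0 + q ^ n * D < e / 2"
    using qpow_tendsto[of 0] by (intro order_tendstoD(2)) auto
  then obtain n where n: "0 + q ^ n * D < e / 2" by (auto simp: eventually_sequentially)
  have "\<forall>\<^sub>F w in at u within {0..1}. dist (curve \<sigma> u) (curve \<sigma> w) \<le> e / 2 + q ^ n * D"
    using e by (intro curve_near assms u) auto
  then show "\<forall>\<^sub>F w in at u within {0..1}. dist (curve \<sigma> w) (curve \<sigma> u) < e"
    by eventually_elim (use n in \<open>simp add: dist_commute\<close>)
qed

lemma curve_onto:
  assumes "\<And>\<sigma>. \<sigma> \<in> S \<Longrightarrow> continuous_on (gap \<sigma>) (base \<sigma>)" "\<sigma> \<in> S"
    and "\<And>x. x \<in> K \<Longrightarrow> \<exists>j y. y \<in> K \<and> x = \<phi> j y" "\<And>\<sigma>. \<sigma> \<in> S \<Longrightarrow> J \<sigma> = UNIV"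
  shows "curve \<sigma> ` {0..1} = K"
proof
  show "curve \<sigma> ` {0..1} \<subseteq> K" using curve_in assms(2) by auto
  show "K \<subseteq> curve \<sigma> ` {0..1}"
  proof
    fix z assume z: "z \<in> K"
    have "closed (curve \<sigma> ` {0..1})"
      using curve_continuous[OF assms(1,2)] by (intro compact_imp_closed compact_continuous_image) auto
    moreover have "z \<in> closure (curve \<sigma> ` {0..1})"
      unfolding closure_approachable
    proof (intro allI impI)
      fix e :: real assume "0 < e"
      then have "\<forall>\<^sub>F n in sequentially. 0 + q ^ n * D < e"
        using qpow_tendsto[of 0] by (intro order_tendstoD(2)) auto
      then obtain n where n: "0 + q ^ n * D < e" by (auto simp: eventually_sequentially)
      then show "\<exists>y\<in>curve \<sigma> ` {0..1}. dist y z < e"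
        using curve_dense[OF assms(3,4,2) z, of n] by force
    qed
    ultimately show "z \<in> curve \<sigma> ` {0..1}" by simp
  qed
qed

end

section \<open>Hoelder estimates for spliced curves\<close>

locale spliced_holder = spliced_curves K \<phi> L q D S J a b child base
  for K :: "'a::metric_space set" and \<phi> L q D and S :: "'s set" and J a b child base +
  fixes \<theta> r H :: real
  assumes \<theta>_pos: "0 < \<theta>" and r: "0 \<le> r" "r < 1" and H_nonneg: "0 \<le> H"
    and speed: "\<sigma> \<in> S \<Longrightarrow> j \<in> J \<sigma> \<Longrightarrow> L j \<le> r * (b \<sigma> j - a \<sigma> j) powr \<theta>"
    and base_holder: "\<sigma> \<in> S \<Longrightarrow> holder_bound \<theta> H (gap \<sigma>) (base \<sigma>)"
begin

text \<open>Compressing time to the length of a piece divides a Hoelder constant by the power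
  \<open>\<theta>\<close> of that length, while \<open>\<phi> j\<close> multiplies it by
  \<open>L j\<close>. By \<open>speed\<close> the net factor is at most \<open>r\<close>.\<close>

lemma piece_step:
  assumes S: "\<sigma> \<in> S" and j: "j \<in> J \<sigma>" and v: "v \<in> {0..1}" "w \<in> {0..1}" and C: "0 \<le> C"
    and *: "dist (curve (child \<sigma> j) v) (curve (child \<sigma> j) w) \<le> C * dist v w powr \<theta> + q ^ n * D"
  shows "dist (curve \<sigma> (pt \<sigma> j v)) (curve \<sigma> (pt \<sigma> j w))
    \<le> r * C * dist (pt \<sigma> j v) (pt \<sigma> j w) powr \<theta> + q ^ Suc n * D"
proof -
  note c = child_in[OF S j]
  have "dist (curve \<sigma> (pt \<sigma> j v)) (curve \<sigma> (pt \<sigma> j w)) \<le> L j * (C * dist v w powr \<theta>) + q ^ Suc n * D"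
    using contracts_qpow[OF curve_in[OF c v(1)] curve_in[OF c v(2)] *] curve_pt[OF S j] v by simp
  also have "L j * (C * dist v w powr \<theta>) \<le> (r * (b \<sigma> j - a \<sigma> j) powr \<theta>) * (C * dist v w powr \<theta>)"
    using speed[OF S j] C by (intro mult_right_mono) auto
  also have "\<dots> = r * C * dist (pt \<sigma> j v) (pt \<sigma> j w) powr \<theta>"
    using piece[OF S j] unfolding dist_pt[OF S j] by (subst powr_mult) auto
  finally show ?thesis by simp
qed

text \<open>The sum of the geometric series with first term \<open>H\<close> and ratio
  \<open>r\<close>: one base curve contributes at each level.\<close>

definition end_const :: real where "end_const = H / (1 - r)"

lemma end_const: "0 \<le> end_const" "H + r * end_const = end_const"
  using H_nonneg r by (auto simp: end_const_def field_simps)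

text \<open>From the end \<open>z\<close> follow the base curve to the end of the piece of
  \<open>u\<close> that faces \<open>z\<close>, which is \<open>pt \<sigma> j z\<close> as
  \<open>z\<close> is 0 or 1. What remains is the same problem for the child, at a cost reduced by
  \<open>r\<close>. So the constant has to satisfy
  \<open>H + r * end_const = end_const\<close>.\<close>

lemma curve_end_n:
  "\<sigma> \<in> S \<Longrightarrow> u \<in> {0..1} \<Longrightarrow> z \<in> {0,1} \<Longrightarrow>
     dist (curve \<sigma> z) (curve \<sigma> u) \<le> end_const * dist z u powr \<theta> + q ^ n * D"
proof (induction n arbitrary: \<sigma> u)
  case 0
  then have "dist (curve \<sigma> z) (curve \<sigma> u) \<le> D" using curve_in diam by auto
  then show ?case using end_const by (simp add: add_increasing)
next
  case (Suc n)
  note S = Suc.prems(1)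
  have pos: "0 \<le> q ^ Suc n * D" using q_nonneg D_nonneg by simp
  have z: "z \<in> gap \<sigma>" using ends_gap[OF S] Suc.prems(3) by auto
  from S Suc.prems(2) show ?case
  proof (cases rule: gap_cases)
    case 1
    have "H * dist z u powr \<theta> \<le> end_const * dist z u powr \<theta>"
      using end_const H_nonneg r by (intro mult_right_mono) (auto simp: end_const_def field_simps mult_left_le)
    then show ?thesis using holder_boundD[OF base_holder[OF S] z 1] curve_gap[OF z] curve_gap[OF 1] pos by simp
  next
    case (2 j)
    have y: "pt \<sigma> j z \<in> gap \<sigma>" using ends_gap[OF S] Suc.prems(3) 2 by auto
    have p: "0 \<le> a \<sigma> j" "b \<sigma> j \<le> 1" using piece[OF S 2(1)] by auto
    note c = child_in[OF S 2(1)]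
    obtain x where x: "x \<in> {0..1}" "u = pt \<sigma> j x" using pt_surj[OF S 2(1)] 2 by (metis atLeastAtMost_iff less_imp_le)
    have "dist (curve \<sigma> (pt \<sigma> j z)) (curve \<sigma> u) \<le> r * end_const * dist (pt \<sigma> j z) u powr \<theta> + q ^ Suc n * D"
      unfolding x(2) using Suc.prems(3) x(1) by (intro piece_step[OF S 2(1)] Suc.IH c end_const) auto
    moreover have "dist (pt \<sigma> j z) u powr \<theta> \<le> dist z u powr \<theta>" "dist z (pt \<sigma> j z) powr \<theta> \<le> dist z u powr \<theta>"
      using Suc.prems(3) \<theta>_pos 2 p by (auto intro!: powr_mono2 simp: dist_real_def)
    then have "r * end_const * dist (pt \<sigma> j z) u powr \<theta> \<le> r * end_const * dist z u powr \<theta>"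
      "H * dist z (pt \<sigma> j z) powr \<theta> \<le> H * dist z u powr \<theta>"
      using r end_const H_nonneg by (auto intro!: mult_left_mono)
    moreover have "dist (curve \<sigma> z) (curve \<sigma> (pt \<sigma> j z)) \<le> H * dist z (pt \<sigma> j z) powr \<theta>"
      using holder_boundD[OF base_holder[OF S] z y] curve_gap[OF z] curve_gap[OF y] by simp
    moreover have "end_const * dist z u powr \<theta> = H * dist z u powr \<theta> + r * end_const * dist z u powr \<theta>"
      using end_const(2) by (metis distrib_right)
    ultimately show ?thesis
      using dist_triangle[of "curve \<sigma> z" "curve \<sigma> u" "curve \<sigma> (pt \<sigma> j z)"] by linarith
  qed
qed

text \<open>An end of a piece corresponds to an end of the child curve, so
  \<open>curve_end_n\<close> applies one level below.\<close>

lemma piece_end_le: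
  assumes S: "\<sigma> \<in> S" and j: "j \<in> J \<sigma>" and u: "u \<in> {a \<sigma> j..b \<sigma> j}" and z: "z \<in> {a \<sigma> j, b \<sigma> j}"
  shows "dist (curve \<sigma> z) (curve \<sigma> u) \<le> end_const * dist z u powr \<theta>"
proof -
  obtain y where y: "y \<in> {0,1}" "z = pt \<sigma> j y" using z by force
  obtain x where x: "x \<in> {0..1}" "u = pt \<sigma> j x" using pt_surj[OF S j u] .
  have "dist (curve \<sigma> z) (curve \<sigma> u) \<le> r * end_const * dist z u powr \<theta> + q ^ n * D" for n
  proof -
    have "dist (curve \<sigma> z) (curve \<sigma> u) \<le> r * end_const * dist z u powr \<theta> + q ^ Suc n * D"
      unfolding x y using y x curve_end_n[OF child_in[OF S j] x(1) y(1)] end_const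
      by (intro piece_step[OF S j]) auto
    moreover have "q ^ Suc n * D \<le> q ^ n * D"
      using q_nonneg q_less D_nonneg by (intro mult_right_mono power_decreasing) auto
    ultimately show ?thesis by linarith
  qed
  then have "dist (curve \<sigma> z) (curve \<sigma> u) \<le> r * end_const * dist z u powr \<theta>" by (rule le_qpow_imp_le)
  also have "\<dots> \<le> 1 * end_const * dist z u powr \<theta>"
    using r end_const by (intro mult_right_mono) auto
  finally show ?thesis by simp
qed

text \<open>If one piece contains both points, descend to its child; since \<open>r < 1\<close> the
  constant does not grow. Otherwise go from \<open>u\<close> to the right end of its piece, along
  the base curve, and from the left end of the piece of \<open>w\<close> to \<open>w\<close>: two
  end estimates and one base estimate.\<close>

lemma curve_holder_n:
  "\<sigma> \<in> S \<Longrightarrow> u \<in> {0..1} \<Longrightarrow> w \<in> {0..1} \<Longrightarrow> u \<le> w \<Longrightarrow>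
     dist (curve \<sigma> u) (curve \<sigma> w) \<le> (2 * end_const + H) * dist u w powr \<theta> + q ^ n * D"
proof (induction n arbitrary: \<sigma> u w)
  case 0
  then have "dist (curve \<sigma> u) (curve \<sigma> w) \<le> D" using curve_in diam by auto
  then show ?case using end_const H_nonneg by (simp add: add_increasing)
next
  case (Suc n)
  note S = Suc.prems(1)
  have pos: "0 \<le> q ^ Suc n * D" using q_nonneg D_nonneg by simp
  show ?case
  proof (cases "\<exists>j\<in>J \<sigma>. u \<in> {a \<sigma> j..b \<sigma> j} \<and> w \<in> {a \<sigma> j..b \<sigma> j}")
    case True
    then obtain j where j: "j \<in> J \<sigma>" "u \<in> {a \<sigma> j..b \<sigma> j}" "w \<in> {a \<sigma> j..b \<sigma> j}" by blast
    obtain x where x: "x \<in> {0..1}" "u = pt \<sigma> j x" using pt_surj[OF S j(1,2)] .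
    obtain y where y: "y \<in> {0..1}" "w = pt \<sigma> j y" using pt_surj[OF S j(1,3)] .
    have "x \<le> y"
      using Suc.prems(4) piece[OF S j(1)] unfolding x y by (simp add: pt_def)
    then have "dist (curve \<sigma> u) (curve \<sigma> w) \<le> r * (2 * end_const + H) * dist u w powr \<theta> + q ^ Suc n * D"
      unfolding x y using x y end_const H_nonneg by (intro piece_step[OF S j(1)] Suc.IH child_in[OF S j(1)]) auto
    moreover have "r * (2 * end_const + H) * dist u w powr \<theta> \<le> 1 * (2 * end_const + H) * dist u w powr \<theta>"
      using r end_const H_nonneg by (intro mult_right_mono) auto
    ultimately show ?thesis by linarith
  next
    case False
    have "\<exists>y\<in>gap \<sigma>. u \<le> y \<and> y \<le> w \<and> dist (curve \<sigma> y) (curve \<sigma> u) \<le> end_const * dist y u powr \<theta> \<and>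
        (y = u \<or> (\<exists>j\<in>J \<sigma>. a \<sigma> j < u \<and> y = b \<sigma> j))"
      using S Suc.prems(2)
    proof (cases rule: gap_cases)
      case 1
      then show ?thesis using Suc.prems(4) by (intro bexI[of _ u]) auto
    next
      case (2 j)
      then have "b \<sigma> j \<le> w" using False Suc.prems(4) by force
      then show ?thesis
        using 2 ends_gap(4)[OF S 2(1)] piece_end_le[OF S 2(1), of u "b \<sigma> j"] by (intro bexI[of _ "b \<sigma> j"]) auto
    qed
    then obtain y where y: "y \<in> gap \<sigma>" "u \<le> y" "y \<le> w" "dist (curve \<sigma> y) (curve \<sigma> u) \<le> end_const * dist y u powr \<theta>"
      by blast
    have "\<exists>z\<in>gap \<sigma>. y \<le> z \<and> z \<le> w \<and> dist (curve \<sigma> z) (curve \<sigma> w) \<le> end_const * dist z w powr \<theta>"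
      using S Suc.prems(3)
    proof (cases rule: gap_cases)
      case 1
      then show ?thesis using y by (intro bexI[of _ w]) auto
    next
      case (2 j)
      \<comment> \<open>A gap point that is at most \<open>w\<close> cannot lie beyond the left end
        of the open piece around \<open>w\<close>.\<close>
      then have "y \<le> a \<sigma> j" using y by (auto simp: gap_def)
      then show ?thesis
        using 2 ends_gap(3)[OF S 2(1)] piece_end_le[OF S 2(1), of w "a \<sigma> j"] by (intro bexI[of _ "a \<sigma> j"]) auto
    qed
    then obtain z where z: "z \<in> gap \<sigma>" "y \<le> z" "z \<le> w" "dist (curve \<sigma> z) (curve \<sigma> w) \<le> end_const * dist z w powr \<theta>"
      by blast
    have "dist (curve \<sigma> y) (curve \<sigma> z) \<le> H * dist y z powr \<theta>"
      using holder_boundD[OF base_holder[OF S] y(1) z(1)] curve_gap[OF y(1)] curve_gap[OF z(1)] by simp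
    moreover have "dist y z powr \<theta> \<le> dist u w powr \<theta>" "dist y u powr \<theta> \<le> dist u w powr \<theta>"
       "dist z w powr \<theta> \<le> dist u w powr \<theta>"
      using \<theta>_pos y z by (auto intro!: powr_mono2 simp: dist_real_def)
    then have "H * dist y z powr \<theta> \<le> H * dist u w powr \<theta>" "end_const * dist y u powr \<theta> \<le> end_const * dist u w powr \<theta>"
       "end_const * dist z w powr \<theta> \<le> end_const * dist u w powr \<theta>"
      using end_const H_nonneg by (auto intro!: mult_left_mono)
    moreover have "dist (curve \<sigma> u) (curve \<sigma> w) \<le>
        dist (curve \<sigma> y) (curve \<sigma> u) + dist (curve \<sigma> y) (curve \<sigma> z) + dist (curve \<sigma> z) (curve \<sigma> w)"
      using dist_triangle[of "curve \<sigma> u" "curve \<sigma> w" "curve \<sigma> y"]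
        dist_triangle[of "curve \<sigma> y" "curve \<sigma> w" "curve \<sigma> z"] by (simp add: dist_commute)
    ultimately show ?thesis using y(4) z(4) pos by (simp add: algebra_simps)
  qed
qed

lemma curve_holder:
  assumes "\<sigma> \<in> S"
  shows "holder_bound \<theta> (2 * end_const + H) {0..1} (curve \<sigma>)"
  unfolding holder_bound_def
proof (intro ballI)
  fix u w :: real assume "u \<in> {0..1}" "w \<in> {0..1}"
  then show "dist (curve \<sigma> u) (curve \<sigma> w) \<le> (2 * end_const + H) * dist u w powr \<theta>"
    using le_qpow_imp_le[OF curve_holder_n[OF assms, of u w]] le_qpow_imp_le[OF curve_holder_n[OF assms, of w u]]
    by (cases "u \<le> w") (auto simp: dist_commute)
qed

end

section \<open>Elementary rules for Hoelder bounds\<close>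

lemma holder_bound_sorted:
  assumes "\<And>x y. x \<in> U \<Longrightarrow> y \<in> U \<Longrightarrow> x < y \<Longrightarrow> dist (f x) (f y) \<le> H * dist x y powr \<theta>"
  shows "holder_bound \<theta> H U f"
  unfolding holder_bound_def
proof (intro ballI)
  fix x y assume "x \<in> U" "y \<in> U"
  then show "dist (f x) (f y) \<le> H * dist x y powr \<theta>"
    using assms[of x y] assms[of y x] by (cases x y rule: linorder_cases) (auto simp: dist_commute)
qed

lemma holder_bound_compose:
  assumes f: "holder_bound \<theta> H U f" and H: "0 \<le> H" and \<theta>: "0 \<le> \<theta>" and m: "0 \<le> m"
    and g: "\<And>x. x \<in> V \<Longrightarrow> g x \<in> U"
    and lip: "\<And>x y. x \<in> V \<Longrightarrow> y \<in> V \<Longrightarrow> dist (g x) (g y) \<le> m * dist x y"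
  shows "holder_bound \<theta> (H * m powr \<theta>) V (\<lambda>x. f (g x))"
  unfolding holder_bound_def
proof (intro ballI)
  fix x y assume xy: "x \<in> V" "y \<in> V"
  have "dist (f (g x)) (f (g y)) \<le> H * dist (g x) (g y) powr \<theta>"
    using f g xy by (auto simp: holder_bound_def)
  also have "\<dots> \<le> H * (m * dist x y) powr \<theta>"
    using lip[OF xy] H \<theta> by (intro mult_left_mono powr_mono2) auto
  also have "\<dots> = H * m powr \<theta> * dist x y powr \<theta>"
    using m by (simp add: powr_mult)
  finally show "dist (f (g x)) (f (g y)) \<le> H * m powr \<theta> * dist x y powr \<theta>" .
qed

lemma holder_bound_cong:
  "(\<And>x. x \<in> U \<Longrightarrow> f x = g x) \<Longrightarrow> holder_bound \<theta> H U f \<longleftrightarrow> holder_bound \<theta> H U g"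
  by (simp add: holder_bound_def)

text \<open>For exponents below 1 the powers of the two partial distances can add up to more than
  the power of the whole distance; hence the sum of the constants and not their maximum.\<close>

lemma holder_bound_join:
  assumes 1: "holder_bound \<theta> H1 {a..b} f" and 2: "holder_bound \<theta> H2 {b..c} f"
    and H: "0 \<le> H1" "0 \<le> H2" and \<theta>: "0 \<le> \<theta>"
  shows "holder_bound \<theta> (H1 + H2) {a..c} f"
proof (rule holder_bound_sorted)
  fix x y assume xy: "x \<in> {a..c}" "y \<in> {a..c}" "x < y"
  consider "y \<le> b" | "b \<le> x" | "x < b" "b < y" by linarith
  then show "dist (f x) (f y) \<le> (H1 + H2) * dist x y powr \<theta>"
  proof cases
    case 1
    then show ?thesis using holder_boundD[OF assms(1), of x y] xy H by (simp add: distrib_right add_increasing2)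
  next
    case 2
    then show ?thesis using holder_boundD[OF assms(2), of x y] xy H by (simp add: distrib_right add_increasing)
  next
    case 3
    have "dist (f x) (f b) \<le> H1 * dist x b powr \<theta>" "dist (f b) (f y) \<le> H2 * dist b y powr \<theta>"
      using 3 xy by (auto intro!: holder_boundD[OF 1] holder_boundD[OF 2])
    moreover have "H1 * dist x b powr \<theta> \<le> H1 * dist x y powr \<theta>" "H2 * dist b y powr \<theta> \<le> H2 * dist x y powr \<theta>"
      using 3 H \<theta> by (auto intro!: mult_left_mono powr_mono2 simp: dist_real_def)
    ultimately show ?thesis
      using dist_triangle[of "f x" "f y" "f b"] by (simp add: distrib_right)
  qed
qed

section \<open>Scheduling countably many detours\<close>

locale weights =
  fixes c :: "nat \<Rightarrow> real" and M :: real
  assumes c_pos: "0 < c i" and c_sums: "c sums M" and M_less: "M < 1"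
begin

definition mass :: "nat set \<Rightarrow> real" where
  "mass A = (\<Sum>j. if j \<in> A then c j else 0)"

lemma mass_summable: "summable (\<lambda>j. if j \<in> A then c j else 0)"
  by (rule summable_comparison_test'[OF sums_summable[OF c_sums], of 0]) (use c_pos in \<open>auto simp: less_imp_le\<close>)

lemma mass_mono: "A \<subseteq> B \<Longrightarrow> mass A \<le> mass B"
  unfolding mass_def by (rule suminf_le) (use c_pos mass_summable in \<open>auto simp: less_imp_le\<close>)

lemma mass_UNIV: "mass UNIV = M"
  using c_sums by (simp add: mass_def sums_iff)

lemma mass_empty [simp]: "mass {} = 0"
  by (simp add: mass_def)

lemma mass_nonneg: "0 \<le> mass A"
  using mass_mono[of "{}" A] by simp

lemma mass_insert:
  assumes "i \<notin> A"
  shows "mass (insert i A) = mass A + c i"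
proof -
  have "(\<lambda>j. if j = i then c j else 0) sums c i"
    by (rule sums_single)
  from sums_add[OF summable_sums[OF mass_summable, of A] this]
  have "(\<lambda>j. (if j \<in> A then c j else 0) + (if j = i then c j else 0)) sums (mass A + c i)"
    by (simp add: mass_def)
  moreover have "(\<lambda>j. (if j \<in> A then c j else 0) + (if j = i then c j else 0)) =
      (\<lambda>j. if j \<in> insert i A then c j else 0)"
    using assms by auto
  ultimately show ?thesis by (simp add: mass_def sums_iff)
qed

lemma c_le: "c i \<le> M" and c_add_le: "i \<noteq> j \<Longrightarrow> c i + c j \<le> M"
  using mass_insert[of i "{}"] mass_insert[of j "{i}"] mass_mono[of "{i}" UNIV] mass_mono[of "{j,i}" UNIV]
  by (auto simp: mass_UNIV)

end

text \<open>The detour at time \<open>s i\<close> takes time \<open>c i\<close>, and detours at equal times are ordered by index.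
  \<open>\<tau>\<close> is the time shown by a clock that is stopped during the detours.\<close>

locale stopped_clock = weights c M for c M +
  fixes s :: "nat \<Rightarrow> real"
  assumes s_in: "s i \<in> {0..1}"
begin

definition before :: "nat \<Rightarrow> nat set" where
  "before i = {j. s j < s i \<or> s j = s i \<and> j < i}"

text \<open>A full run of the clock takes time \<open>1 - M\<close> and all detours together take
  \<open>M\<close>, so everything fits into unit time.\<close>

definition start :: "nat \<Rightarrow> real" where
  "start i = (1 - M) * s i + mass (before i)"

definition arrival :: "real \<Rightarrow> real" where
  "arrival t = (1 - M) * t + mass {j. s j < t}"

text \<open>The generalised inverse of \<open>arrival\<close>. A jump of \<open>arrival\<close>,
  caused by detours, becomes an interval on which \<open>\<tau>\<close> is constant.\<close>

definition \<tau> :: "real \<Rightarrow> real" where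
  "\<tau> u = Sup {t \<in> {0..1}. arrival t \<le> u}"

lemma start_after:
  assumes "j \<in> before i"
  shows "start j + c j \<le> start i"
proof -
  have "mass (insert j (before j)) \<le> mass (before i)"
    using assms by (intro mass_mono) (auto simp: before_def)
  moreover have "mass (insert j (before j)) = mass (before j) + c j"
    by (rule mass_insert) (simp add: before_def)
  moreover have "(1 - M) * s j \<le> (1 - M) * s i"
    using assms M_less by (intro mult_left_mono) (auto simp: before_def)
  ultimately show ?thesis by (simp add: start_def)
qed

lemma detours_disjoint: "i \<noteq> j \<Longrightarrow> start i + c i \<le> start j \<or> start j + c j \<le> start i"
proof -
  assume "i \<noteq> j"
  then have "i \<in> before j \<or> j \<in> before i"
    by (cases "s i" "s j" rule: linorder_cases) (auto simp: before_def)
  then show ?thesis using start_after by blast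
qed

lemma start_bounds: "0 \<le> start i" "start i + c i \<le> 1"
proof -
  show "0 \<le> start i"
    using s_in[of i] M_less mass_nonneg by (auto simp: start_def)
  have "mass (before i) + c i \<le> M"
    using mass_insert[of i "before i"] mass_mono[of "insert i (before i)" UNIV]
    by (simp add: before_def mass_UNIV)
  moreover have "(1 - M) * s i \<le> (1 - M) * 1"
    using s_in[of i] M_less by (intro mult_left_mono) auto
  ultimately show "start i + c i \<le> 1" by (simp add: start_def)
qed

lemma arrival_diff: "t \<le> t' \<Longrightarrow> (1 - M) * (t' - t) \<le> arrival t' - arrival t"
proof -
  assume "t \<le> t'"
  then have "mass {j. s j < t} \<le> mass {j. s j < t'}" by (intro mass_mono) auto
  then show ?thesis by (simp add: arrival_def algebra_simps)
qed

lemma arrival_0: "arrival 0 = 0" and arrival_1: "arrival 1 \<le> 1"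
proof -
  have "{j. s j < 0} = {}" using s_in by (auto simp: not_less)
  then show "arrival 0 = 0" by (simp add: arrival_def)
  show "arrival 1 \<le> 1" using mass_mono[of _ UNIV] by (simp add: arrival_def mass_UNIV)
qed

lemma \<tau>_upper: "t \<in> {0..1} \<Longrightarrow> arrival t \<le> u \<Longrightarrow> t \<le> \<tau> u"
  unfolding \<tau>_def by (rule cSup_upper) (auto intro: bdd_aboveI[of _ 1])

lemma \<tau>_least: "0 \<le> u \<Longrightarrow> (\<And>t. t \<in> {0..1} \<Longrightarrow> arrival t \<le> u \<Longrightarrow> t \<le> z) \<Longrightarrow> \<tau> u \<le> z"
  unfolding \<tau>_def using arrival_0 by (intro cSup_least) (auto intro!: exI[of _ 0])

lemma \<tau>_in: "0 \<le> u \<Longrightarrow> \<tau> u \<in> {0..1}"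
  using \<tau>_upper[of 0 u] \<tau>_least[of u 1] arrival_0 by auto

lemma \<tau>_0: "\<tau> 0 = 0"
proof -
  have "t \<le> 0" if "t \<in> {0..1}" "arrival t \<le> 0" for t
  proof (rule ccontr)
    assume "\<not> t \<le> 0"
    then have "0 < (1 - M) * (t - 0)" using M_less by simp
    then show False using that arrival_diff[of 0 t] arrival_0 by simp
  qed
  then have "\<tau> 0 \<le> 0" by (intro \<tau>_least) auto
  then show ?thesis using \<tau>_in[of 0] by simp
qed

lemma \<tau>_1: "\<tau> 1 = 1"
  using \<tau>_upper[of 1 1] \<tau>_in[of 1] arrival_1 by auto

lemma \<tau>_mono: "0 \<le> u \<Longrightarrow> u \<le> w \<Longrightarrow> \<tau> u \<le> \<tau> w"
  by (rule \<tau>_least) (auto intro: \<tau>_upper)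

text \<open>\<open>arrival\<close> has slope at least \<open>1 - M\<close>, so its inverse has slope
  at most \<open>1 / (1 - M)\<close>.\<close>

lemma \<tau>_diff:
  assumes "0 \<le> u" "u \<le> w"
  shows "\<tau> w \<le> \<tau> u + (w - u) / (1 - M)"
proof (rule \<tau>_least)
  fix t assume t: "t \<in> {0..1}" "arrival t \<le> w"
  show "t \<le> \<tau> u + (w - u) / (1 - M)"
  proof (rule ccontr)
    assume "\<not> ?thesis"
    then have lt: "\<tau> u + (w - u) / (1 - M) < t" by simp
    moreover have nn: "0 \<le> (w - u) / (1 - M)" using assms M_less by simp
    \<comment> \<open>Going back from \<open>t\<close> by the claimed bound still leaves
      \<open>y\<close> beyond \<open>\<tau> u\<close>, so \<open>arrival y\<close> exceeds
      \<open>u\<close>; the slope of \<open>arrival\<close> then pushes \<open>arrival t\<close>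
      above \<open>w\<close>.\<close>
    define y where "y = t - (w - u) / (1 - M)"
    have y: "\<tau> u < y" "y \<le> t" using lt nn by (auto simp: y_def)
    have "y \<in> {0..1}" using y \<tau>_in[OF assms(1)] t(1) by auto
    then have "u < arrival y" using \<tau>_upper[of y u] y by force
    moreover have "(1 - M) * (t - y) = w - u" using M_less by (simp add: y_def)
    ultimately show False using arrival_diff[OF y(2)] t(2) by linarith
  qed
qed (use assms in auto)

lemma \<tau>_lipschitz:
  assumes "0 \<le> u" "0 \<le> w"
  shows "dist (\<tau> u) (\<tau> w) \<le> 1 / (1 - M) * dist u w"
  using \<tau>_diff[of u w] \<tau>_diff[of w u] \<tau>_mono[of u w] \<tau>_mono[of w u] assms
  by (cases "u \<le> w") (auto simp: dist_real_def)

text \<open>The clock has reached \<open>s i\<close> when detour \<open>i\<close> starts, and any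
  later clock time is reached only strictly after this detour has ended.\<close>

lemma \<tau>_detour:
  assumes "u \<in> {start i..start i + c i}"
  shows "\<tau> u = s i"
proof (rule antisym)
  have u: "0 \<le> u" using assms start_bounds[of i] by simp
  have "arrival (s i) \<le> start i"
    unfolding arrival_def start_def by (intro add_left_mono mass_mono) (auto simp: before_def)
  then show "s i \<le> \<tau> u" using assms s_in by (intro \<tau>_upper) auto
  show "\<tau> u \<le> s i"
  proof (rule \<tau>_least[OF u])
    fix t assume t: "t \<in> {0..1}" "arrival t \<le> u"
    show "t \<le> s i"
    proof (rule ccontr)
      assume "\<not> t \<le> s i"
      then have "mass (insert i (before i)) \<le> mass {j. s j < t}"
        by (intro mass_mono) (auto simp: before_def)
      moreover have "mass (insert i (before i)) = mass (before i) + c i"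
        by (rule mass_insert) (simp add: before_def)
      moreover have "(1 - M) * s i < (1 - M) * t"
        using \<open>\<not> t \<le> s i\<close> M_less by (intro mult_strict_left_mono) auto
      ultimately show False using t(2) assms by (simp add: arrival_def start_def)
    qed
  qed
qed

end

section \<open>Curves through the attractor\<close>

locale crossing_system = contractions K \<phi> L q D + weights c M
  for K :: "'a::metric_space set" and \<phi> L q D c M +
  fixes \<gamma> :: "real \<Rightarrow> 'a" and t :: "nat \<Rightarrow> real" and \<kappa> :: "nat \<Rightarrow> 'a"
    and head :: "'a \<Rightarrow> nat" and rest :: "'a \<Rightarrow> 'a"
  assumes \<gamma>_cont: "continuous_on {0..1} \<gamma>" and \<gamma>_in: "u \<in> {0..1} \<Longrightarrow> \<gamma> u \<in> K"
    and t_in: "t i \<in> {0..1}" and \<kappa>_in: "\<kappa> i \<in> K" and crossing: "\<gamma> (t i) = \<phi> i (\<kappa> i)"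
    and rest_in: "x \<in> K \<Longrightarrow> rest x \<in> K" and head_rest: "x \<in> K \<Longrightarrow> \<phi> (head x) (rest x) = x"
begin

text \<open>If \<open>x\<close> and \<open>y\<close> lie in the same \<open>\<phi> i ` K\<close>, the curve from \<open>x\<close> to \<open>y\<close> is the \<open>\<phi> i\<close>-image of another
  one. Thus no curve uses a map twice, and the pieces fit into total time \<open>M < 1\<close>.\<close>

fun link_pieces :: "'a \<times> 'a \<Rightarrow> nat set" where
  "link_pieces (x, y) = {head x, head y}"

text \<open>Different heads give an initial and a final piece of lengths \<open>c (head x)\<close>
  and \<open>c (head y)\<close>. For equal heads the same formulas give a single piece filling the
  unit interval, whose child joins \<open>rest x\<close> to \<open>rest y\<close>.\<close>

fun link_a :: "'a \<times> 'a \<Rightarrow> nat \<Rightarrow> real" where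
  "link_a (x, y) j = (if j = head x then 0 else 1 - c j)"

fun link_b :: "'a \<times> 'a \<Rightarrow> nat \<Rightarrow> real" where
  "link_b (x, y) j = (if j = head y then 1 else c j)"

fun link_child :: "'a \<times> 'a \<Rightarrow> nat \<Rightarrow> 'a \<times> 'a" where
  "link_child (x, y) j = (if j = head x then rest x else \<kappa> j, if j = head y then rest y else \<kappa> j)"

text \<open>Between the two pieces \<open>\<gamma>\<close> is traversed from time \<open>t i\<close>
  to time \<open>t j\<close>, possibly backwards. Clamping makes the formula Lipschitz on the whole
  line.\<close>

definition link_pos :: "nat \<Rightarrow> nat \<Rightarrow> real \<Rightarrow> real" where
  "link_pos i j u = t i + (t j - t i) * max 0 (min 1 ((u - c i) / (1 - c i - c j)))"

text \<open>For different heads 0 and 1 are isolated points of the gap, so prescribing the values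
  there does not destroy continuity on the gap.\<close>

fun link_base :: "'a \<times> 'a \<Rightarrow> real \<Rightarrow> 'a" where
  "link_base (x, y) u = (if u = 0 then x else if u = 1 then y else \<gamma> (link_pos (head x) (head y) u))"

lemma link_pos_in: "link_pos i j u \<in> {0..1}"
proof -
  define w where "w = max 0 (min 1 ((u - c i) / (1 - c i - c j)))"
  have "w \<in> {0..1}" by (auto simp: w_def)
  then have "(1 - w) * t i + w * t j \<in> {0..1}"
    using convex_real_interval(5)[of 0 1] t_in[of i] t_in[of j]
    unfolding convex_alt by (metis atLeastAtMost_iff real_scaleR_def)
  then show ?thesis unfolding link_pos_def w_def[symmetric] by (simp add: algebra_simps)
qed

text \<open>Two different indices use at most \<open>M\<close> of the unit time, so at least
  \<open>1 - M\<close> remains for the middle part, uniformly in \<open>i\<close> and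
  \<open>j\<close>.\<close>

lemma link_pos_lipschitz:
  assumes "i \<noteq> j"
  shows "dist (link_pos i j u) (link_pos i j w) \<le> 1 / (1 - M) * dist u w"
proof -
  define f where "f u = (u - c i) / (1 - c i - c j)" for u
  have d: "1 - M \<le> 1 - c i - c j" using c_add_le[OF assms] by simp
  have "\<bar>f u - f w\<bar> = \<bar>u - w\<bar> / (1 - c i - c j)"
    using d M_less by (simp add: f_def abs_divide flip: diff_divide_distrib)
  also have "\<dots> \<le> \<bar>u - w\<bar> / (1 - M)" using d M_less by (intro divide_left_mono) auto
  finally have *: "\<bar>max 0 (min 1 (f u)) - max 0 (min 1 (f w))\<bar> \<le> 1 / (1 - M) * \<bar>u - w\<bar>"
    by (auto simp: max_def min_def)
  have "\<bar>link_pos i j u - link_pos i j w\<bar> = \<bar>t j - t i\<bar> * \<bar>max 0 (min 1 (f u)) - max 0 (min 1 (f w))\<bar>"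
    by (simp add: link_pos_def f_def abs_mult flip: right_diff_distrib)
  also have "\<dots> \<le> 1 * \<bar>max 0 (min 1 (f u)) - max 0 (min 1 (f w))\<bar>"
    using t_in[of i] t_in[of j] by (intro mult_right_mono) auto
  finally show ?thesis using * by (simp add: dist_real_def)
qed

lemma link_base_c:
  assumes "head x \<noteq> head y"
  shows "link_base (x, y) (c (head x)) = \<gamma> (t (head x))"
    and "link_base (x, y) (1 - c (head y)) = \<gamma> (t (head y))"
proof -
  have *: "c (head x) + c (head y) < 1" using c_add_le[OF assms] M_less by simp
  show "link_base (x, y) (c (head x)) = \<gamma> (t (head x))"
    using * c_pos[of "head x"] c_pos[of "head y"] by (simp add: link_pos_def)
  have "(1 - c (head y) - c (head x)) / (1 - c (head x) - c (head y)) = 1"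
    using * by simp
  then show "link_base (x, y) (1 - c (head y)) = \<gamma> (t (head y))"
    using * c_pos[of "head x"] c_pos[of "head y"] by (simp add: link_pos_def)
qed

text \<open>The outer ends match by \<open>head_rest\<close>. At an inner end the base curve is at a
  crossing \<open>\<gamma> (t j) = \<phi> j (\<kappa> j)\<close>, which is why the child curve has
  \<open>\<kappa> j\<close> as its end there.\<close>

sublocale link: spliced_curves K \<phi> L q D "K \<times> K" link_pieces link_a link_b link_child link_base
proof
  fix \<sigma> :: "'a \<times> 'a" and i j :: nat and u :: real
  assume "\<sigma> \<in> K \<times> K"
  then obtain x y where \<sigma>: "\<sigma> = (x, y)" and xy: "x \<in> K" "y \<in> K" by auto
  have c: "0 < c i" "c i < 1" for i using c_pos[of i] c_le[of i] M_less by auto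
  show "u \<in> {0..1} \<Longrightarrow> link_base \<sigma> u \<in> K" using xy \<gamma>_in link_pos_in by (simp add: \<sigma>)
  assume j: "j \<in> link_pieces \<sigma>"
  show "0 \<le> link_a \<sigma> j \<and> link_a \<sigma> j < link_b \<sigma> j \<and> link_b \<sigma> j \<le> 1"
    using c[of j] j by (auto simp: \<sigma>)
  show "link_child \<sigma> j \<in> K \<times> K" using xy rest_in \<kappa>_in by (simp add: \<sigma>)
  show "link_base \<sigma> (link_a \<sigma> j) = \<phi> j (link_base (link_child \<sigma> j) 0)"
    using j xy link_base_c[of x y] head_rest[OF xy(1)] head_rest[OF xy(2)] crossing
    by (cases "j = head x") (auto simp: \<sigma> simp del: link_base.simps(1), auto)
  show "link_base \<sigma> (link_b \<sigma> j) = \<phi> j (link_base (link_child \<sigma> j) 1)"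
    using j xy link_base_c[of x y] head_rest[OF xy(1)] head_rest[OF xy(2)] crossing
    by (cases "j = head y") (auto simp: \<sigma> simp del: link_base.simps(1), auto)
  assume i: "i \<in> link_pieces \<sigma>" "i \<noteq> j"
  show "link_b \<sigma> i \<le> link_a \<sigma> j \<or> link_b \<sigma> j \<le> link_a \<sigma> i"
    using i j c_add_le[of i j] M_less by (auto simp: \<sigma>)
qed

lemma link_gap:
  assumes "head x \<noteq> head y"
  shows "link.gap (x, y) = {0} \<union> {c (head x)..1 - c (head y)} \<union> {1}"
  using assms c_pos[of "head x"] c_pos[of "head y"] c_le[of "head x"] c_le[of "head y"]
    c_add_le[OF assms] M_less by (auto simp: link.gap_def)

lemma link_gap_same:
  assumes "head x = head y"
  shows "link.gap (x, y) = {0, 1}"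
  using assms by (auto simp: link.gap_def)

lemma link_base_cont:
  assumes "\<sigma> \<in> K \<times> K"
  shows "continuous_on (link.gap \<sigma>) (link_base \<sigma>)"
proof -
  obtain x y where \<sigma>: "\<sigma> = (x, y)" by (cases \<sigma>)
  show ?thesis
  proof (cases "head x = head y")
    case True
    then show ?thesis by (simp add: \<sigma> link_gap_same continuous_on_finite)
  next
    case False
    have lip: "(1 / (1 - M))-lipschitz_on UNIV (link_pos (head x) (head y))"
      using link_pos_lipschitz[OF False] M_less by (intro lipschitz_onI) auto
    have "continuous_on UNIV (link_pos (head x) (head y))"
      using lip by (rule lipschitz_on_continuous_on)
    then have "continuous_on {c (head x)..1 - c (head y)} (\<lambda>u. \<gamma> (link_pos (head x) (head y) u))"
      using link_pos_in by (intro continuous_on_compose2[OF \<gamma>_cont]) (auto intro: continuous_on_subset)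
    moreover have "link_base (x, y) u = \<gamma> (link_pos (head x) (head y) u)"
      if "u \<in> {c (head x)..1 - c (head y)}" for u
      using that c_pos[of "head x"] c_pos[of "head y"] by auto
    ultimately have "continuous_on {c (head x)..1 - c (head y)} (link_base (x, y))"
      using continuous_on_cong by (metis (no_types, lifting))
    then show ?thesis
      unfolding \<sigma> link_gap[OF False] by (intro continuous_on_closed_Un) auto
  qed
qed

abbreviation link :: "'a \<Rightarrow> 'a \<Rightarrow> real \<Rightarrow> 'a" where
  "link x y \<equiv> link.curve (x, y)"

lemma link_ends: "x \<in> K \<Longrightarrow> y \<in> K \<Longrightarrow> link x y 0 = x" "x \<in> K \<Longrightarrow> y \<in> K \<Longrightarrow> link x y 1 = y"
  by (simp_all add: link.curve_0 link.curve_1)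

lemma link_cont: "x \<in> K \<Longrightarrow> y \<in> K \<Longrightarrow> continuous_on {0..1} (link x y)"
  by (intro link.curve_continuous link_base_cont) auto

section \<open>Loops along the given curve and the filling loops\<close>

definition tour :: "'a \<Rightarrow> real \<Rightarrow> 'a" where
  "tour x u = (if u \<le> 1/3 then link x (\<gamma> 0) (3 * u)
     else if u \<le> 2/3 then \<gamma> (3 * u - 1) else link (\<gamma> 1) x (3 * u - 2))"

lemma \<gamma>_ends_in: "\<gamma> 0 \<in> K" "\<gamma> 1 \<in> K"
  by (auto intro: \<gamma>_in)

lemma tour_eqs:
  assumes "x \<in> K"
  shows "u \<in> {0..1/3} \<Longrightarrow> tour x u = link x (\<gamma> 0) (3 * u)"
    and "u \<in> {1/3..2/3} \<Longrightarrow> tour x u = \<gamma> (3 * u - 1)"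
    and "u \<in> {2/3..1} \<Longrightarrow> tour x u = link (\<gamma> 1) x (3 * u - 2)"
proof -
  show "u \<in> {0..1/3} \<Longrightarrow> tour x u = link x (\<gamma> 0) (3 * u)" by (simp add: tour_def)
  show "tour x u = \<gamma> (3 * u - 1)" if "u \<in> {1/3..2/3}"
  proof (cases "u = 1/3")
    case True
    show ?thesis unfolding True using link_ends[OF assms \<gamma>_ends_in(1)] by (simp add: tour_def)
  qed (use that in \<open>auto simp: tour_def\<close>)
  show "tour x u = link (\<gamma> 1) x (3 * u - 2)" if "u \<in> {2/3..1}"
  proof (cases "u = 2/3")
    case True
    show ?thesis unfolding True using link_ends[OF \<gamma>_ends_in(2) assms] by (simp add: tour_def)
  qed (use that in \<open>auto simp: tour_def\<close>)
qed

lemma thirds: "{0..1::real} = {0..1/3} \<union> {1/3..2/3} \<union> {2/3..1}"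
  by auto

lemma tour_in:
  assumes "x \<in> K" "u \<in> {0..1}"
  shows "tour x u \<in> K"
proof -
  consider "u \<in> {0..1/3}" | "u \<in> {1/3..2/3}" | "u \<in> {2/3..1}"
    using assms(2) unfolding thirds by blast
  then show ?thesis
  proof cases
    case 1
    then show ?thesis using tour_eqs(1)[OF assms(1) 1] assms(1) \<gamma>_ends_in by (simp add: link.curve_in)
  next
    case 2
    then show ?thesis using tour_eqs(2)[OF assms(1) 2] by (simp add: \<gamma>_in)
  next
    case 3
    then show ?thesis using tour_eqs(3)[OF assms(1) 3] assms(1) \<gamma>_ends_in by (simp add: link.curve_in)
  qed
qed

lemma tour_cont:
  assumes "x \<in> K"
  shows "continuous_on {0..1} (tour x)"
proof -
  have "continuous_on {0..1/3} (tour x)"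
    by (rule continuous_on_eq[OF continuous_on_compose2[OF link_cont[OF assms \<gamma>_ends_in(1)]] tour_eqs(1)[OF assms, symmetric]])
      (auto intro!: continuous_intros)
  moreover have "continuous_on {1/3..2/3} (tour x)"
    by (rule continuous_on_eq[OF continuous_on_compose2[OF \<gamma>_cont] tour_eqs(2)[OF assms, symmetric]])
      (auto intro!: continuous_intros)
  moreover have "continuous_on {2/3..1} (tour x)"
    by (rule continuous_on_eq[OF continuous_on_compose2[OF link_cont[OF \<gamma>_ends_in(2) assms]] tour_eqs(3)[OF assms, symmetric]])
      (auto intro!: continuous_intros)
  ultimately show ?thesis
    unfolding thirds by (intro continuous_on_closed_Un) auto
qed

text \<open>The middle third of a tour runs through all of \<open>\<gamma>\<close>, so
  \<open>(1 + t i) / 3\<close> is a time at which it passes the crossing with index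
  \<open>i\<close>.\<close>

sublocale clock: stopped_clock c M "\<lambda>i. (1 + t i) / 3"
proof
  show "(1 + t i) / 3 \<in> {0..1}" for i
    using t_in[of i] by simp
qed

lemma tour_0: "x \<in> K \<Longrightarrow> tour x 0 = x" and tour_1: "x \<in> K \<Longrightarrow> tour x 1 = x"
  using link_ends \<gamma>_ends_in by (simp_all add: tour_def)

lemma tour_crossing:
  assumes "x \<in> K" "u \<in> {clock.start i..clock.start i + c i}"
  shows "tour x (clock.\<tau> u) = \<phi> i (\<kappa> i)"
  using tour_eqs(2)[OF assms(1), of "(1 + t i) / 3"] t_in[of i] crossing
  by (simp add: clock.\<tau>_detour[OF assms(2)] field_simps)

text \<open>While the clock is stopped for detour \<open>i\<close>, the tour waits at
  \<open>\<phi> i (\<kappa> i)\<close>; the tour of \<open>\<kappa> i\<close> starts and ends at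
  \<open>\<kappa> i\<close>, so its image fits in. Every index has a piece, as
  \<open>curve_onto\<close> requires.\<close>

sublocale fill: spliced_curves K \<phi> L q D K "\<lambda>_. UNIV" "\<lambda>_. clock.start" "\<lambda>_ i. clock.start i + c i"
    "\<lambda>_. \<kappa>" "\<lambda>x u. tour x (clock.\<tau> u)"
proof
  fix x u and i j :: nat assume x: "x \<in> K"
  show "u \<in> {0..1} \<Longrightarrow> tour x (clock.\<tau> u) \<in> K" using tour_in[OF x] clock.\<tau>_in by simp
  show "0 \<le> clock.start j \<and> clock.start j < clock.start j + c j \<and> clock.start j + c j \<le> 1"
    using clock.start_bounds c_pos by simp
  show "\<kappa> j \<in> K" by (rule \<kappa>_in)
  show "tour x (clock.\<tau> (clock.start j)) = \<phi> j (tour (\<kappa> j) (clock.\<tau> 0))"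
    using c_pos[of j] by (simp add: tour_crossing[OF x, of _ j] clock.\<tau>_0 tour_0 \<kappa>_in)
  show "tour x (clock.\<tau> (clock.start j + c j)) = \<phi> j (tour (\<kappa> j) (clock.\<tau> 1))"
    using c_pos[of j] by (simp add: tour_crossing[OF x, of _ j] clock.\<tau>_1 tour_1 \<kappa>_in)
  show "i \<noteq> j \<Longrightarrow> clock.start i + c i \<le> clock.start j \<or> clock.start j + c j \<le> clock.start i"
    by (rule clock.detours_disjoint)
qed

lemma fill_base_cont:
  assumes "x \<in> K"
  shows "continuous_on (fill.gap x) (\<lambda>u. tour x (clock.\<tau> u))"
proof -
  have "(1 / (1 - M))-lipschitz_on (fill.gap x) clock.\<tau>"
    using clock.\<tau>_lipschitz M_less fill.gap_sub by (intro lipschitz_onI) auto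
  then have "continuous_on (fill.gap x) clock.\<tau>" by (rule lipschitz_on_continuous_on)
  then show ?thesis
    using clock.\<tau>_in fill.gap_sub by (intro continuous_on_compose2[OF tour_cont[OF assms]]) auto
qed

lemma fill_path: "path (fill.curve (\<gamma> 0))"
  unfolding path_def by (intro fill.curve_continuous fill_base_cont \<gamma>_ends_in)

lemma fill_image: "path_image (fill.curve (\<gamma> 0)) = K"
proof -
  have "\<exists>j y. y \<in> K \<and> x = \<phi> j y" if "x \<in> K" for x
    using rest_in[OF that] head_rest[OF that] by metis
  then show ?thesis
    unfolding path_image_def by (intro fill.curve_onto fill_base_cont \<gamma>_ends_in) auto
qed

end

section \<open>Hoelder bounds for the links, tours and filling loops\<close>

locale crossing_system_holder = crossing_system K \<phi> L q D c M \<gamma> t \<kappa> head rest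
  for K :: "'a::metric_space set" and \<phi> L q D c M \<gamma> t \<kappa> head rest +
  fixes \<theta> r G :: real
  assumes \<theta>_pos: "0 < \<theta>" and r: "0 \<le> r" "r < 1" and G_nonneg: "0 \<le> G"
    and L_speed: "L j \<le> r * c j powr \<theta>"
    and \<gamma>_holder: "holder_bound \<theta> G {0..1} \<gamma>"
begin

definition \<gamma>_const :: real where "\<gamma>_const = G * (1 / (1 - M)) powr \<theta>"

lemma \<gamma>_const_nonneg: "0 \<le> \<gamma>_const"
  using G_nonneg by (simp add: \<gamma>_const_def)

text \<open>These are the jumps of the base curve across the two pieces. Both points lie in the same
  image of \<open>K\<close>, whose diameter is controlled by \<open>L_speed\<close> in terms of the
  time spent on the piece.\<close>

lemma link_base_c_near:
  assumes "head x \<noteq> head y" "x \<in> K" "y \<in> K"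
  shows "dist x (link_base (x, y) (c (head x))) \<le> D * c (head x) powr \<theta>"
    and "dist (link_base (x, y) (1 - c (head y))) y \<le> D * c (head y) powr \<theta>"
proof -
  have *: "dist (\<phi> j v) (\<phi> j w) \<le> D * c j powr \<theta>" if "v \<in> K" "w \<in> K" for j v w
  proof -
    have "dist (\<phi> j v) (\<phi> j w) \<le> L j * D"
      by (rule order_trans[OF contracts[OF that] mult_left_mono[OF diam[OF that] L_nonneg]])
    also have "\<dots> \<le> (r * c j powr \<theta>) * D"
      using L_speed D_nonneg by (intro mult_right_mono) auto
    also have "\<dots> \<le> (1 * c j powr \<theta>) * D"
      using r D_nonneg by (intro mult_right_mono) auto
    finally show ?thesis by (simp add: mult.commute)
  qed
  show "dist x (link_base (x, y) (c (head x))) \<le> D * c (head x) powr \<theta>"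
    using *[OF rest_in[OF assms(2)] \<kappa>_in, of "head x"] head_rest[OF assms(2)]
    by (simp only: link_base_c[OF assms(1)] crossing)
  show "dist (link_base (x, y) (1 - c (head y))) y \<le> D * c (head y) powr \<theta>"
    using *[OF \<kappa>_in rest_in[OF assms(3)], of "head y"] head_rest[OF assms(3)]
    by (simp only: link_base_c[OF assms(1)] crossing)
qed

text \<open>For equal heads the gap consists of two points at distance 1. Otherwise the middle part
  inherits its bound from \<open>\<gamma>\<close>, and the jumps to the isolated points 0 and 1 are
  paid for by \<open>link_base_c_near\<close>.\<close>

lemma link_base_holder:
  assumes "\<sigma> \<in> K \<times> K"
  shows "holder_bound \<theta> (2 * D + \<gamma>_const) (link.gap \<sigma>) (link_base \<sigma>)"
proof -
  obtain x y where \<sigma>: "\<sigma> = (x, y)" and xy: "x \<in> K" "y \<in> K" using assms by auto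
  have D: "dist x y \<le> D" using diam xy by blast
  show ?thesis
  proof (cases "head x = head y")
    case True
    then show ?thesis
      using D D_nonneg \<gamma>_const_nonneg
      by (intro holder_bound_sorted) (auto simp: \<sigma> link_gap_same dist_commute)
  next
    case False
    let ?f = "link_base (x, y)" and ?c = "c (head x)" and ?d = "1 - c (head y)"
    have cd: "0 < ?c" "?c \<le> ?d" "?d < 1"
      using c_pos c_add_le[OF False] M_less by (auto simp: algebra_simps)
    have "holder_bound \<theta> \<gamma>_const {?c..?d} (\<lambda>u. \<gamma> (link_pos (head x) (head y) u))"
      unfolding \<gamma>_const_def using link_pos_lipschitz[OF False] \<theta>_pos M_less link_pos_in G_nonneg
      by (intro holder_bound_compose[OF \<gamma>_holder]) auto
    then have mid: "holder_bound \<theta> \<gamma>_const {?c..?d} ?f"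
      using cd by (subst holder_bound_cong) auto
    have bound: "E * w powr \<theta> \<le> E' * v powr \<theta>" if "0 \<le> E" "E \<le> E'" "0 \<le> w" "w \<le> v" for E E' w v
      using that \<theta>_pos by (intro mult_mono powr_mono2) auto
    have ends: "?f 0 = x" "?f 1 = y" by simp_all
    show ?thesis
      unfolding \<sigma>
    proof (rule holder_bound_sorted)
      fix u v assume uv: "u \<in> link.gap (x, y)" "v \<in> link.gap (x, y)" "u < v"
      then consider "u = 0" "v = 1" | "u = 0" "v \<in> {?c..?d}" | "u \<in> {?c..?d}" "v = 1"
        | "u \<in> {?c..?d}" "v \<in> {?c..?d}"
        using cd unfolding link_gap[OF False] by (auto simp del: link_base.simps)
      then show "dist (?f u) (?f v) \<le> (2 * D + \<gamma>_const) * dist u v powr \<theta>"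
      proof cases
        case 1
        have "D \<le> 2 * D + \<gamma>_const" using D_nonneg \<gamma>_const_nonneg by simp
        then show ?thesis using D unfolding 1 ends by simp
      next
        case 2
        have "dist (?f ?c) (?f v) \<le> \<gamma>_const * dist ?c v powr \<theta>"
          using 2 cd by (intro holder_boundD[OF mid]) auto
        also have "\<dots> \<le> \<gamma>_const * dist u v powr \<theta>"
          using 2 cd \<gamma>_const_nonneg by (intro bound) (auto simp: dist_real_def)
        finally have "dist (?f ?c) (?f v) \<le> \<gamma>_const * dist u v powr \<theta>" .
        moreover have "D * ?c powr \<theta> \<le> (2 * D) * dist u v powr \<theta>"
          using 2 cd D_nonneg by (intro bound) (auto simp: dist_real_def)
        moreover have "dist (?f u) (?f ?c) \<le> D * ?c powr \<theta>"
          using link_base_c_near(1)[OF False xy] unfolding 2(1) ends .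
        ultimately show ?thesis
          using dist_triangle[of "?f u" "?f v" "?f ?c"] unfolding distrib_right by linarith
      next
        case 3
        have "dist (?f u) (?f ?d) \<le> \<gamma>_const * dist u ?d powr \<theta>"
          using 3 cd by (intro holder_boundD[OF mid]) auto
        also have "\<dots> \<le> \<gamma>_const * dist u v powr \<theta>"
          using 3 cd \<gamma>_const_nonneg by (intro bound) (auto simp: dist_real_def)
        finally have "dist (?f u) (?f ?d) \<le> \<gamma>_const * dist u v powr \<theta>" .
        moreover have "D * c (head y) powr \<theta> \<le> (2 * D) * dist u v powr \<theta>"
          using 3 cd D_nonneg by (intro bound) (auto simp: dist_real_def)
        moreover have "dist (?f ?d) (?f v) \<le> D * c (head y) powr \<theta>"
          using link_base_c_near(2)[OF False xy] unfolding 3(2) ends .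
        ultimately show ?thesis
          using dist_triangle[of "?f u" "?f v" "?f ?d"] unfolding distrib_right by linarith
      next
        case 4
        have "\<gamma>_const * dist u v powr \<theta> \<le> (2 * D + \<gamma>_const) * dist u v powr \<theta>"
          using D_nonneg \<gamma>_const_nonneg by (intro bound) auto
        then show ?thesis using holder_boundD[OF mid 4] by linarith
      qed
    qed
  qed
qed

sublocale linkh: spliced_holder K \<phi> L q D "K \<times> K" link_pieces link_a link_b link_child link_base \<theta> r "2 * D + \<gamma>_const"
proof
  fix \<sigma> j assume \<sigma>: "\<sigma> \<in> K \<times> K" and j: "j \<in> link_pieces \<sigma>"
  \<comment> \<open>The piece has length \<open>c j\<close>, or length 1 when both heads
    agree.\<close>
  have "c j \<le> link_b \<sigma> j - link_a \<sigma> j"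
  proof -
    obtain x y where xy: "\<sigma> = (x, y)" by (cases \<sigma>)
    have "c j < 1" using c_le[of j] M_less by linarith
    then show ?thesis
      using j c_pos[of j] unfolding xy by (cases "j = head x"; cases "j = head y") simp_all
  qed
  then have "r * c j powr \<theta> \<le> r * (link_b \<sigma> j - link_a \<sigma> j) powr \<theta>"
    using \<theta>_pos r c_pos[of j] by (intro mult_left_mono powr_mono2) auto
  then show "L j \<le> r * (link_b \<sigma> j - link_a \<sigma> j) powr \<theta>"
    using L_speed[of j] by linarith
qed (use \<theta>_pos r D_nonneg \<gamma>_const_nonneg link_base_holder in auto)

definition link_const :: real where "link_const = 2 * linkh.end_const + (2 * D + \<gamma>_const)"

lemma link_const_nonneg: "0 \<le> link_const"
  using linkh.end_const(1) D_nonneg \<gamma>_const_nonneg by (simp add: link_const_def)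

lemma link_holder: "x \<in> K \<Longrightarrow> y \<in> K \<Longrightarrow> holder_bound \<theta> link_const {0..1} (link x y)"
  unfolding link_const_def by (intro linkh.curve_holder) auto

definition tour_const :: real where
  "tour_const = link_const * 3 powr \<theta> + G * 3 powr \<theta> + link_const * 3 powr \<theta>"

lemma tour_const_nonneg: "0 \<le> tour_const"
  using link_const_nonneg G_nonneg by (simp add: tour_const_def)

text \<open>Each third runs at triple speed. The constant is the same for all \<open>x\<close>,
  since \<open>base_holder\<close> needs one constant for the whole family.\<close>

lemma tour_holder:
  assumes "x \<in> K"
  shows "holder_bound \<theta> tour_const {0..1} (tour x)"
  unfolding tour_const_def
proof (intro holder_bound_join)
  have thrice: "dist (3 * u - d) (3 * v - d) \<le> 3 * dist u v" for u v d :: real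
    by (simp add: dist_real_def abs_if)
  have "holder_bound \<theta> (link_const * 3 powr \<theta>) {0..1/3} (\<lambda>u. link x (\<gamma> 0) (3 * u))"
    using link_const_nonneg G_nonneg \<theta>_pos thrice thrice[of _ 0]
    by (intro holder_bound_compose[OF link_holder[OF assms \<gamma>_ends_in(1)]]) auto
  then show "holder_bound \<theta> (link_const * 3 powr \<theta>) {0..1/3} (tour x)"
    by (rule holder_bound_cong[THEN iffD2, rotated]) (rule tour_eqs(1)[OF assms])
  have "holder_bound \<theta> (G * 3 powr \<theta>) {1/3..2/3} (\<lambda>u. \<gamma> (3 * u - 1))"
    using link_const_nonneg G_nonneg \<theta>_pos thrice thrice[of _ 0]
    by (intro holder_bound_compose[OF \<gamma>_holder]) auto
  then show "holder_bound \<theta> (G * 3 powr \<theta>) {1/3..2/3} (tour x)"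
    by (rule holder_bound_cong[THEN iffD2, rotated]) (rule tour_eqs(2)[OF assms])
  have "holder_bound \<theta> (link_const * 3 powr \<theta>) {2/3..1} (\<lambda>u. link (\<gamma> 1) x (3 * u - 2))"
    using link_const_nonneg G_nonneg \<theta>_pos thrice thrice[of _ 0]
    by (intro holder_bound_compose[OF link_holder[OF \<gamma>_ends_in(2) assms]]) auto
  then show "holder_bound \<theta> (link_const * 3 powr \<theta>) {2/3..1} (tour x)"
    by (rule holder_bound_cong[THEN iffD2, rotated]) (rule tour_eqs(3)[OF assms])
qed (use link_const_nonneg G_nonneg \<theta>_pos in auto)

sublocale fillh: spliced_holder K \<phi> L q D K "\<lambda>_. UNIV" "\<lambda>_. clock.start" "\<lambda>_ i. clock.start i + c i"
    "\<lambda>_. \<kappa>" "\<lambda>x u. tour x (clock.\<tau> u)" \<theta> r "tour_const * (1 / (1 - M)) powr \<theta>"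
proof
  fix x assume x: "x \<in> K"
  show "holder_bound \<theta> (tour_const * (1 / (1 - M)) powr \<theta>) (fill.gap x) (\<lambda>u. tour x (clock.\<tau> u))"
    using tour_const_nonneg \<theta>_pos M_less clock.\<tau>_in clock.\<tau>_lipschitz fill.gap_sub
    by (intro holder_bound_compose[OF tour_holder[OF x]]) auto
qed (use \<theta>_pos r tour_const_nonneg L_speed in auto)

lemma fill_holder: "holder_on \<theta> {0..1} (fill.curve (\<gamma> 0))"
proof -
  have "0 \<le> 2 * fillh.end_const + tour_const * (1 / (1 - M)) powr \<theta>"
    using fillh.end_const(1) fillh.H_nonneg by simp
  then show ?thesis
    using fillh.curve_holder[OF \<gamma>_ends_in(1)] unfolding holder_on_def holder_bound_def by blast
qed

end

section \<open>Attractors of iterated function systems\<close>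

text \<open>The infimum is itself a Lipschitz constant, because every difference quotient is a lower
  bound of the set of constants.\<close>

lemma Lip_lipschitz:
  assumes "C-lipschitz_on X f"
  shows "(Lip X f)-lipschitz_on X f"
proof -
  let ?S = "{L. 0 < L \<and> L-lipschitz_on X f}"
  have "max C 1 \<in> ?S" using lipschitz_on_le[OF assms, of "max C 1"] by simp
  then have ne: "?S \<noteq> {}" by blast
  have nn: "0 \<le> Lip X f"
    unfolding Lip_def using ne by (intro cInf_greatest) auto
  show "(Lip X f)-lipschitz_on X f"
  proof (rule lipschitz_onI[OF _ nn])
    fix x y assume xy: "x \<in> X" "y \<in> X"
    show "dist (f x) (f y) \<le> Lip X f * dist x y"
    proof (cases "x = y")
      case False
      then have "0 < dist x y" by simp
      then have "dist (f x) (f y) / dist x y \<le> L" if "L \<in> ?S" for L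
        using that xy lipschitz_onD[of L X f x y] by (simp add: divide_le_eq)
      then have "dist (f x) (f y) / dist x y \<le> Lip X f"
        unfolding Lip_def using ne by (intro cInf_greatest) auto
      then show ?thesis using \<open>0 < dist x y\<close> by (simp add: divide_le_eq)
    qed simp
  qed
qed

text \<open>The recursion of \<open>iterate\<close> splits off the innermost map; arguments about
  addresses need the outermost one, the first letter.\<close>

lemma iterate_shift: "iterate \<phi> w (Suc n) = \<phi> (w 0) \<circ> iterate \<phi> (\<lambda>k. w (Suc k)) n"
  by (induction n) (auto simp: fun_eq_iff)

text \<open>Almost all terms are below \<open>1 / 2\<close>, and the finitely many others have a
  maximum below 1.\<close>

lemma less_one_uniform:
  fixes L :: "nat \<Rightarrow> real"
  assumes "L \<longlonglongrightarrow> 0" "\<And>i. L i < 1"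
  obtains q where "0 < q" "q < 1" "\<And>i. L i \<le> q"
proof -
  have "\<forall>\<^sub>F i in sequentially. L i < 1 / 2"
    using assms(1) by (intro order_tendstoD(2)) auto
  then obtain N where N: "\<And>i. i \<ge> N \<Longrightarrow> L i < 1 / 2" by (auto simp: eventually_sequentially)
  let ?q = "Max (insert (1 / 2) (L ` {..<N}))"
  have "1 / 2 \<le> ?q" by (rule Max_ge) auto
  moreover have "?q < 1" using assms(2) by (subst Max_less_iff) auto
  moreover have "L i \<le> ?q" for i
  proof (cases "i < N")
    case True
    then show ?thesis by (intro Max_ge) auto
  next
    case False
    then show ?thesis using N[of i] \<open>1 / 2 \<le> ?q\<close> by simp
  qed
  ultimately show ?thesis using that[of ?q] by simp
qed

section \<open>Invariance of the attractor under the maps\<close>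

locale compact_maps =
  fixes X :: "'a::metric_space set" and \<phi> :: "nat \<Rightarrow> 'a \<Rightarrow> 'a"
  assumes compact_X: "compact X"
    and maps: "x \<in> X \<Longrightarrow> \<phi> i x \<in> X"
    and cont: "continuous_on X (\<phi> i)"
begin

lemma iterate_in: "x \<in> X \<Longrightarrow> iterate \<phi> w n x \<in> X"
  by (induction n arbitrary: x) (auto simp: maps)

lemma iterate_cont: "continuous_on X (iterate \<phi> w n)"
proof (induction n)
  case 0
  show ?case by (simp add: continuous_on_id)
next
  case (Suc n)
  have "\<phi> (w n) ` X \<subseteq> X" using maps by auto
  then show ?case
    unfolding iterate.simps by (intro continuous_on_compose cont continuous_on_subset[OF Suc])
qed

lemma iterate_decseq: "decseq (\<lambda>n. iterate \<phi> w n ` X)"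
  by (rule decseq_SucI) (auto simp: maps image_comp[symmetric])

lemma in_attractorI:
  assumes "\<And>n. x \<in> iterate \<phi> w n ` X"
  shows "x \<in> attractor X \<phi>"
  using assms unfolding attractor_def by blast

lemma in_attractorE:
  assumes "x \<in> attractor X \<phi>"
  obtains w where "\<And>n. x \<in> iterate \<phi> w n ` X"
proof -
  obtain w where w: "\<And>n. 1 \<le> n \<Longrightarrow> x \<in> iterate \<phi> w n ` X"
    using assms by (auto simp: attractor_def)
  \<comment> \<open>The intersection defining the attractor starts at 1; level 0 follows since the
    images decrease.\<close>
  have "x \<in> iterate \<phi> w n ` X" for n
    using w[of n] w[of 1] decseqD[OF iterate_decseq, of 0 1 w] by (cases n) auto
  then show ?thesis by (rule that)
qed

lemma attractor_subset: "attractor X \<phi> \<subseteq> X"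
proof
  fix x assume "x \<in> attractor X \<phi>"
  then obtain w where "\<And>n. x \<in> iterate \<phi> w n ` X" using in_attractorE by blast
  from this[of 0] show "x \<in> X" by simp
qed

lemma attractor_maps:
  assumes "x \<in> attractor X \<phi>"
  shows "\<phi> i x \<in> attractor X \<phi>"
proof -
  obtain w where w: "\<And>n. x \<in> iterate \<phi> w n ` X" using in_attractorE[OF assms] by blast
  have "\<phi> i x \<in> iterate \<phi> (case_nat i w) n ` X" for n
  proof (cases n)
    case 0
    then show ?thesis using maps attractor_subset assms by auto
  next
    case (Suc m)
    then show ?thesis using w[of m] by (auto simp: iterate_shift simp del: iterate.simps)
  qed
  then show ?thesis by (rule in_attractorI)
qed

text \<open>The maps need not be injective, so the preimages of \<open>x\<close> obtained at
  different levels may differ. A limit point of them lies in all the nested compact images, and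
  continuity keeps it a preimage of \<open>x\<close>.\<close>

lemma attractor_cover:
  assumes "x \<in> attractor X \<phi>"
  obtains i y where "y \<in> attractor X \<phi>" "x = \<phi> i y"
proof -
  obtain w where w: "\<And>n. x \<in> iterate \<phi> w n ` X" using in_attractorE[OF assms] by blast
  let ?v = "\<lambda>k. w (Suc k)"
  have "\<exists>y. y \<in> iterate \<phi> ?v n ` X \<and> x = \<phi> (w 0) y" for n
    using w[of "Suc n"] unfolding iterate_shift by auto
  then obtain f where f: "\<And>n. f n \<in> iterate \<phi> ?v n ` X" "\<And>n. x = \<phi> (w 0) (f n)"
    by metis
  have fX: "f n \<in> X" for n using f(1)[of n] iterate_in by auto
  obtain y r where y: "y \<in> X" "strict_mono r" "(f \<circ> r) \<longlonglongrightarrow> y"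
    using compact_X fX unfolding compact_def by metis
  have "y \<in> iterate \<phi> ?v m ` X" for m
  proof (rule Lim_in_closed_set[OF _ _ _ y(3)])
    show "closed (iterate \<phi> ?v m ` X)"
      by (intro compact_imp_closed compact_continuous_image iterate_cont compact_X)
    have "f (r n) \<in> iterate \<phi> ?v m ` X" if "m \<le> n" for n
    proof -
      have "m \<le> r n" using that seq_suble[OF y(2), of n] by simp
      then show ?thesis using f(1)[of "r n"] decseqD[OF iterate_decseq] by blast
    qed
    then show "\<forall>\<^sub>F n in sequentially. (f \<circ> r) n \<in> iterate \<phi> ?v m ` X"
      by (auto simp: eventually_sequentially)
  qed simp
  moreover have "x = \<phi> (w 0) y"
  proof (rule LIMSEQ_unique)
    have "(\<lambda>n. \<phi> (w 0) ((f \<circ> r) n)) = (\<lambda>n. x)" using f(2) by (simp add: fun_eq_iff)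
    then show "(\<lambda>n. \<phi> (w 0) ((f \<circ> r) n)) \<longlonglongrightarrow> x" by simp
    show "(\<lambda>n. \<phi> (w 0) ((f \<circ> r) n)) \<longlonglongrightarrow> \<phi> (w 0) y"
      using y fX by (intro continuous_on_tendsto_compose[OF cont]) (auto simp: o_def)
  qed
  ultimately show ?thesis using that in_attractorI by blast
qed

end

text \<open>Each term shrinks at least by the factor \<open>q powr (\<beta> - t)\<close>, which is
  below 1. The strict bound leaves time for travelling along the base curves.\<close>

lemma psi_less_one:
  assumes pos: "\<And>i. 0 < Lip X (\<phi> i)" and le: "\<And>i. Lip X (\<phi> i) \<le> q" and q: "0 < q" "q < 1"
    and psi: "psi X \<phi> t \<le> 1" and "t < \<beta>"
  obtains M where "(\<lambda>i. Lip X (\<phi> i) powr \<beta>) sums M" "M < 1"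
proof -
  let ?f = "\<lambda>i. Lip X (\<phi> i) powr t" and ?g = "\<lambda>i. Lip X (\<phi> i) powr \<beta>" and ?r = "q powr (\<beta> - t)"
  have "psi X \<phi> t \<noteq> top" using psi by (auto simp: top_unique)
  then have f: "summable ?f"
    unfolding psi_def by (intro summable_suminf_not_top) auto
  then have "ennreal (suminf ?f) \<le> 1"
    using psi unfolding psi_def by (subst (asm) suminf_ennreal2) auto
  then have f1: "suminf ?f \<le> 1" by simp
  have gf: "?g i \<le> ?r * ?f i" for i
  proof -
    have "?g i = Lip X (\<phi> i) powr (\<beta> - t) * ?f i" by (simp flip: powr_add)
    also have "\<dots> \<le> ?r * ?f i"
      using pos[of i] le[of i] assms(6) by (intro mult_right_mono powr_mono2) auto
    finally show ?thesis .
  qed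
  have g: "summable ?g"
    using gf by (intro summable_comparison_test'[OF summable_mult[OF f, of ?r], of 0]) auto
  have "suminf ?g \<le> (\<Sum>i. ?r * ?f i)"
    by (intro suminf_le gf g summable_mult f)
  also have "\<dots> = ?r * suminf ?f" by (rule suminf_mult[OF f])
  also have "\<dots> \<le> ?r * 1" using f1 by (intro mult_left_mono) auto
  also have "\<dots> < 1" using q assms(6) powr_less_mono2[of "\<beta> - t" q 1] by simp
  finally show ?thesis using that summable_sums[OF g] by blast
qed

theorem theorem1p2:
  fixes X :: "'a::metric_space set"
    and \<phi> :: "nat \<Rightarrow> 'a \<Rightarrow> 'a"
    and \<gamma> :: "real \<Rightarrow> 'a"
  assumes "IIFS X \<phi>"
    and "compact (attractor X \<phi>)"
    and "(\<lambda>i. Lip X (\<phi> i)) \<longlonglongrightarrow> 0"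
    and "path \<gamma>"
    and "path_image \<gamma> \<subseteq> attractor X \<phi>"
    and "\<And>i. path_image \<gamma> \<inter> \<phi> i ` attractor X \<phi> \<noteq> {}"
  shows "(\<exists>g. path g \<and> path_image g = attractor X \<phi>) \<and>
    (\<forall>s\<ge>1. holder_on (1 / s) {0..1} \<gamma> \<longrightarrow>
      (\<forall>\<alpha>::real. ereal \<alpha> > max (ereal s) (s_dim X \<phi>) \<longrightarrow>
        (\<exists>g. path g \<and> path_image g = attractor X \<phi> \<and> holder_on (1 / \<alpha>) {0..1} g)))"
proof -
  let ?K = "attractor X \<phi>"
  define L where "L i = Lip X (\<phi> i)" for i
  have L: "0 < L i" "L i < 1" for i
    using assms(1) by (auto simp: IIFS_def L_def)
  obtain q where q: "0 < q" "q < 1" "\<And>i. L i \<le> q"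
    using less_one_uniform[of L] assms(3) L(2) unfolding L_def by metis
  have lip: "(L i)-lipschitz_on X (\<phi> i)" for i
    using assms(1) Lip_lipschitz unfolding IIFS_def L_def by blast
  interpret compact_maps X \<phi>
    using assms(1) lip by unfold_locales (auto simp: IIFS_def intro: lipschitz_on_continuous_on)
  have "\<exists>u k. u \<in> {0..1} \<and> k \<in> ?K \<and> \<gamma> u = \<phi> i k" for i
    using assms(6)[of i] by (force simp: path_image_def)
  then obtain t \<kappa> where t: "\<And>i. t i \<in> {0..1}" "\<And>i. \<kappa> i \<in> ?K" "\<And>i. \<gamma> (t i) = \<phi> i (\<kappa> i)"
    by metis
  have "\<exists>i y. x \<in> ?K \<longrightarrow> y \<in> ?K \<and> \<phi> i y = x" for x
    using attractor_cover[of x] by metis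
  then obtain head rest where hr: "\<And>x. x \<in> ?K \<Longrightarrow> rest x \<in> ?K" "\<And>x. x \<in> ?K \<Longrightarrow> \<phi> (head x) (rest x) = x"
    by metis
  have bounded: "bounded ?K" using assms(2) by (rule compact_imp_bounded)
  \<comment> \<open>The weights stay arbitrary because the two claims use different ones.\<close>
  have sys: "crossing_system ?K \<phi> L q (diameter ?K) c M \<gamma> t \<kappa> head rest"
    if "\<And>i. 0 < c i" "c sums M" "M < 1" for c M
  proof
    show "dist (\<phi> j x) (\<phi> j y) \<le> L j * dist x y" if "x \<in> ?K" "y \<in> ?K" for j x y
      using attractor_subset that by (intro lipschitz_onD[OF lip]) auto
    show "0 \<le> L j" for j using L[of j] by simp
    show "L \<longlonglongrightarrow> 0" using assms(3) unfolding L_def .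
    show "\<gamma> u \<in> ?K" if "u \<in> {0..1}" for u using assms(5) that by (auto simp: path_image_def)
    show "continuous_on {0..1} \<gamma>" using assms(4) by (simp add: path_def)
    show "dist x y \<le> diameter ?K" if "x \<in> ?K" "y \<in> ?K" for x y
      using bounded that by (rule diameter_bounded_bound)
    show "0 \<le> diameter ?K" using bounded by (rule diameter_ge_0)
  qed (use that q t hr assms(2) attractor_maps in \<open>blast+\<close>)
  show ?thesis
  proof (intro conjI allI impI)
    \<comment> \<open>Mere continuity works with any positive weights of total below 1; these add up
      to \<open>1 / 2\<close>.\<close>
    interpret crossing_system ?K \<phi> L q "diameter ?K" "\<lambda>i. 1 / 2 * (1 / 2) ^ Suc i" "1 / 2 * 1" \<gamma> t \<kappa> head rest
      by (intro sys sums_mult power_half_series) auto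
    show "\<exists>g. path g \<and> path_image g = ?K"
      using fill_path fill_image by blast
  next
    fix s \<alpha> :: real
    assume s: "1 \<le> s" and \<gamma>: "holder_on (1 / s) {0..1} \<gamma>" and \<alpha>: "max (ereal s) (s_dim X \<phi>) < ereal \<alpha>"
    then have "s < \<alpha>" "s_dim X \<phi> < ereal \<alpha>" by auto
    \<comment> \<open>The infimum lies below \<open>\<alpha>\<close>, so some admissible exponent
      does too.\<close>
    then obtain z where z: "0 \<le> z" "psi X \<phi> z \<le> 1" "z < \<alpha>"
      unfolding s_dim_def Inf_less_iff by auto
    \<comment> \<open>\<open>z < \<beta>\<close> makes the total time less than 1, and
      \<open>\<beta> < \<alpha>\<close> makes the factor \<open>r\<close> less than 1.\<close>
    define \<beta> where "\<beta> = (z + \<alpha>) / 2"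
    have \<beta>: "z < \<beta>" "\<beta> < \<alpha>" using z by (auto simp: \<beta>_def)
    define c where "c i = L i powr \<beta>" for i
    obtain M where M: "c sums M" "M < 1"
      using psi_less_one[OF L(1)[unfolded L_def] q(3)[unfolded L_def] q(1,2) z(2) \<beta>(1)]
      unfolding c_def L_def by metis
    have c: "0 < c i" for i using L(1)[of i] by (simp add: c_def)
    obtain G where G: "0 \<le> G" "\<And>x y. x \<in> {0..1} \<Longrightarrow> y \<in> {0..1} \<Longrightarrow> dist (\<gamma> x) (\<gamma> y) \<le> G * dist x y powr (1 / s)"
      using \<gamma> unfolding holder_on_def by blast
    have hG: "holder_bound (1 / \<alpha>) G {0..1} \<gamma>"
      unfolding holder_bound_def
    proof (intro ballI)
      fix x y :: real assume xy: "x \<in> {0..1}" "y \<in> {0..1}"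
      \<comment> \<open>Distances in the unit interval are at most 1, so the smaller exponent gives
        the larger power.\<close>
      have "dist x y powr (1 / s) \<le> dist x y powr (1 / \<alpha>)"
        using xy s \<open>s < \<alpha>\<close> by (intro powr_mono') (auto simp: dist_real_def field_simps)
      then show "dist (\<gamma> x) (\<gamma> y) \<le> G * dist x y powr (1 / \<alpha>)"
        using G(2)[OF xy] mult_left_mono[OF _ G(1)] by (meson order_trans)
    qed
    \<comment> \<open>With \<open>c j = L j powr \<beta>\<close>, the power
      \<open>c j powr (1 / \<alpha>)\<close> equals \<open>L j powr (\<beta> / \<alpha>)\<close>;
      the surplus \<open>L j powr (1 - \<beta> / \<alpha>)\<close> is at most \<open>r\<close> for
      every \<open>j\<close>.\<close>
    define r where "r = q powr (1 - \<beta> / \<alpha>)"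
    have pos: "0 < \<alpha>" "0 < 1 - \<beta> / \<alpha>" using s \<open>s < \<alpha>\<close> \<beta> by (auto simp: field_simps)
    have r: "0 \<le> r" "r < 1"
      using q pos powr_less_mono2[of "1 - \<beta> / \<alpha>" q 1] by (auto simp: r_def)
    have speed: "L j \<le> r * c j powr (1 / \<alpha>)" for j
    proof -
      have "L j = L j powr (1 - \<beta> / \<alpha>) * c j powr (1 / \<alpha>)"
        using L(1)[of j] by (simp add: c_def powr_powr flip: powr_add)
      also have "\<dots> \<le> r * c j powr (1 / \<alpha>)"
        unfolding r_def using L(1)[of j] q(3)[of j] pos by (intro mult_right_mono powr_mono2) auto
      finally show ?thesis .
    qed
    interpret crossing_system ?K \<phi> L q "diameter ?K" c M \<gamma> t \<kappa> head rest
      by (intro sys c M)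
    interpret crossing_system_holder ?K \<phi> L q "diameter ?K" c M \<gamma> t \<kappa> head rest "1 / \<alpha>" r G
      by unfold_locales (use pos r G hG speed in auto)
    show "\<exists>g. path g \<and> path_image g = ?K \<and> holder_on (1 / \<alpha>) {0..1} g"
      using fill_path fill_image fill_holder by blast
  qed
qed

end
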